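(* Let $k$ be an algebraically closed field of characteristic $p>0$ ($p$ any prime) and let $\mathfrak g=\mathfrak{sl}_3$ (type $A_2$) over $k$. For each $r\ge 1$, $$\dim C_r(\mathfrak u_1)=\begin{cases}2r+1 & \text{if } p\ne2,\\ 2r & \text{if } p=2,\end{cases} \qquad\text{and}\qquad \dim C_r(\mathcal N_1)=\begin{cases}2r+4 & \text{if } p\neq2,\\ 2r+2 & \text{if } p=2.\end{cases}$$
   Context: $\mathcal N_1=\{x\in\mathfrak g:x^{[p]}=0\}$, where $x^{[p]}$ is the $p$-th matrix power; $\mathfrak u$ is the space of strictly upper triangular matrices in $\mathfrak g$ and $\mathfrak u_1=\mathcal N_1\cap\mathfrak u$. For a closed subvariety $V\subseteq\mathfrak g$, $C_r(V)=\{(x_1,\dots,x_r)\in V^r:[x_i,x_j]=0,\ 1\le i\le j\le r\}$. *)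

theory Defs
  imports "HOL-Analysis.Analysis" "HOL-Computational_Algebra.Polynomial"
begin

section \<open>Zariski topology\<close>

text \<open>
  An affine space over a field is given by its set \<open>E\<close> of points together with its set \<open>X\<close> of
  coordinate functions. Polynomials only enter through the functions they define on points.
\<close>

inductive_set poly_funs :: "('v \<Rightarrow> 'k::field) set \<Rightarrow> ('v \<Rightarrow> 'k) set"
  for X :: "('v \<Rightarrow> 'k) set" where
  coord: "f \<in> X \<Longrightarrow> f \<in> poly_funs X"
| const: "(\<lambda>_. c) \<in> poly_funs X"
| add: "\<lbrakk>f \<in> poly_funs X; g \<in> poly_funs X\<rbrakk> \<Longrightarrow> (\<lambda>x. f x + g x) \<in> poly_funs X"
| mult: "\<lbrakk>f \<in> poly_funs X; g \<in> poly_funs X\<rbrakk> \<Longrightarrow> (\<lambda>x. f x * g x) \<in> poly_funs X"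

definition zero_locus :: "'v set \<Rightarrow> ('v \<Rightarrow> 'k::field) set \<Rightarrow> 'v set" where
  "zero_locus E F = {x \<in> E. \<forall>f\<in>F. f x = 0}"

definition zariski :: "'v set \<Rightarrow> ('v \<Rightarrow> 'k::field) set \<Rightarrow> 'v topology" where
  "zariski E X = topology (\<lambda>U. \<exists>F\<subseteq>poly_funs X. U = E - zero_locus E F)"

lemma openin_zariski:
  fixes X :: "('v \<Rightarrow> 'k::field) set"
  shows "openin (zariski E X) U \<longleftrightarrow> (\<exists>F\<subseteq>poly_funs X. U = E - zero_locus E F)"
proof -
  let ?P = "\<lambda>U. \<exists>F\<subseteq>poly_funs X. U = E - zero_locus E F"
  have int: "?P (S \<inter> T)" if S: "?P S" and T: "?P T" for S T
  proof -
    from S obtain F where F: "F \<subseteq> poly_funs X" "S = E - zero_locus E F" by blast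
    from T obtain G where G: "G \<subseteq> poly_funs X" "T = E - zero_locus E G" by blast
    let ?H = "(\<lambda>(f, g) x. f x * g x) ` (F \<times> G)"
    have "?H \<subseteq> poly_funs X" using F(1) G(1) by (auto intro: poly_funs.mult)
    moreover have locus: "x \<in> zero_locus E ?H \<longleftrightarrow> x \<in> E \<and> (\<forall>f\<in>F. \<forall>g\<in>G. f x * g x = 0)" for x
      by (simp add: zero_locus_def split_beta)
    moreover have "S \<inter> T = E - zero_locus E ?H"
      unfolding F(2) G(2) by (auto simp: locus) (auto simp: zero_locus_def)
    ultimately show ?thesis by (intro exI conjI)
  qed
  have un: "?P (\<Union>\<K>)" if K: "\<forall>S\<in>\<K>. ?P S" for \<K>
  proof -
    from bchoice[OF K] obtain F
      where F: "\<forall>S\<in>\<K>. F S \<subseteq> poly_funs X \<and> S = E - zero_locus E (F S)" ..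
    have "(\<Union>S\<in>\<K>. F S) \<subseteq> poly_funs X" using F by blast
    moreover have "\<Union>\<K> = (\<Union>S\<in>\<K>. E - zero_locus E (F S))" using F by auto
    then have "\<Union>\<K> = E - zero_locus E (\<Union>S\<in>\<K>. F S)" by (auto simp: zero_locus_def)
    ultimately show ?thesis by blast
  qed
  have "istopology ?P" unfolding istopology_def using int un by auto
  then show ?thesis unfolding zariski_def by (simp add: topology_inverse')
qed

lemma topspace_zariski [simp]: "topspace (zariski E X) = E"
proof
  show "topspace (zariski E X) \<subseteq> E"
    unfolding topspace_def openin_zariski by blast
  have "{\<lambda>_. 1} \<subseteq> poly_funs X" by (auto intro: poly_funs.const)
  moreover have "E = E - zero_locus E {\<lambda>_. 1}" by (auto simp: zero_locus_def)
  ultimately have "openin (zariski E X) E" unfolding openin_zariski by blast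
  then show "E \<subseteq> topspace (zariski E X)" by (rule openin_subset)
qed

lemma closedin_zariski: "closedin (zariski E X) Z \<longleftrightarrow> (\<exists>F\<subseteq>poly_funs X. Z = zero_locus E F)"
proof -
  have sub: "zero_locus E F \<subseteq> E" for F :: "('a \<Rightarrow> 'b) set" by (auto simp: zero_locus_def)
  have "Z \<subseteq> E \<and> E - Z = E - zero_locus E F \<longleftrightarrow> Z = zero_locus E F" for F :: "('a \<Rightarrow> 'b) set"
    using sub[of F] by blast
  then show ?thesis unfolding closedin_def openin_zariski topspace_zariski by blast
qed


section \<open>Krull dimension\<close>

definition irreducible_space :: "'v topology \<Rightarrow> bool" where
  "irreducible_space T \<longleftrightarrow> topspace T \<noteq> {} \<and>
     (\<forall>A B. closedin T A \<and> closedin T B \<and> A \<union> B = topspace T \<longrightarrow>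
        A = topspace T \<or> B = topspace T)"

text \<open>The empty space gets dimension \<open>0\<close> here, since \<open>enat\<close> has no negative values.\<close>

definition krull_dim :: "'v topology \<Rightarrow> enat" where
  "krull_dim T = Sup {enat n | n. \<exists>Z :: nat \<Rightarrow> 'v set.
     (\<forall>i\<le>n. closedin T (Z i) \<and> irreducible_space (subtopology T (Z i))) \<and>
     (\<forall>i<n. Z i \<subset> Z (Suc i))}"


section \<open>Commuting varieties in \<open>\<ss>\<ll>\<^sub>3\<close>\<close>

definition sl3 :: "('k::field ^ 3 ^ 3) set" where
  "sl3 = {x. trace x = 0}"

text \<open>The library's \<open>x ^ n\<close> on type \<open>'k ^ 3 ^ 3\<close> is the entrywise power, hence this definition.\<close>

primrec matrix_pow :: "'k::field ^ 'n ^ 'n \<Rightarrow> nat \<Rightarrow> 'k ^ 'n ^ 'n" where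
  "matrix_pow x 0 = mat 1"
| "matrix_pow x (Suc n) = x ** matrix_pow x n"

definition lie :: "'k::field ^ 'n ^ 'n \<Rightarrow> 'k ^ 'n ^ 'n \<Rightarrow> 'k ^ 'n ^ 'n" where
  "lie x y = x ** y - y ** x"

definition nil1 :: "('k::field ^ 3 ^ 3) set" where
  "nil1 = {x \<in> sl3. matrix_pow x CHAR('k) = 0}"

text \<open>
  The elements of the index type \<open>3\<close> are \<open>0 < 1 < 2\<close>; the numeral \<open>3\<close> denotes \<open>0\<close> in it.
\<close>

definition strict_upper :: "('k::field ^ 3 ^ 3) set" where
  "strict_upper = {x \<in> sl3. \<forall>i j. j \<le> i \<longrightarrow> x $ i $ j = 0}"

definition u1 :: "('k::field ^ 3 ^ 3) set" where
  "u1 = nil1 \<inter> strict_upper"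

text \<open>
  An \<open>r\<close>-tuple is a function on \<open>{..<r}\<close>, extended by \<open>undefined\<close>, so that it is determined by its
  \<open>r\<close> entries.
\<close>

definition comm_tuples :: "nat \<Rightarrow> ('k::field ^ 3 ^ 3) set \<Rightarrow> (nat \<Rightarrow> 'k ^ 3 ^ 3) set" where
  "comm_tuples r V = {x \<in> {..<r} \<rightarrow>\<^sub>E V. \<forall>j<r. \<forall>i\<le>j. lie (x i) (x j) = 0}"

definition tuple_space :: "nat \<Rightarrow> (nat \<Rightarrow> 'k::field ^ 3 ^ 3) topology" where
  "tuple_space r = zariski ({..<r} \<rightarrow>\<^sub>E UNIV) {(\<lambda>x. x i $ a $ b) | i a b. i < r}"

definition variety_dim :: "nat \<Rightarrow> (nat \<Rightarrow> 'k::field ^ 3 ^ 3) set \<Rightarrow> enat" where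
  "variety_dim r V = krull_dim (subtopology (tuple_space r) V)"

end

theory Submission
  imports Defs
begin

text \<open>
  For the upper bounds, every commuting tuple of nilpotent matrices preserves a common flag, so the
  variety is covered by finitely many polynomial images of affine spaces: three parameters describe
  the flag in one of finitely many charts, and in a basis adapted to the flag the \<open>n\<close>-th
  matrix is strictly upper triangular with entries \<open>a n, b n\<close> above the diagonal and \<open>c n\<close> in the
  corner. The only nonzero entry of a product of two such matrices is \<open>a n * b n'\<close> in the corner.
  Hence commuting means that the vectors \<open>a\<close> and \<open>b\<close> are proportional, which leaves \<open>r + 1\<close>
  parameters for them and \<open>r\<close> for \<open>c\<close>. Cubes vanish, so for \<open>p \<noteq> 2\<close> this is all and the numbers
  of parameters are \<open>2 r + 1\<close> and \<open>2 r + 4\<close>. For \<open>p = 2\<close> also \<open>a n * b n = 0\<close>, hence \<open>a = 0\<close> or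
  \<open>b = 0\<close>: the slope disappears, and the matrices depend only on the line or only on the plane of
  the flag, which has two parameters instead of three. This gives \<open>2 r\<close> and \<open>2 r + 2\<close>.

  That such an image has dimension at most the number of parameters is proved by counting: functions
  that separate the members of a chain of irreducible closed subsets are algebraically
  independent on the top member (\<open>chain_functions_independent\<close>), whereas more than \<open>n\<close> polynomials
  in \<open>n\<close> variables are algebraically dependent (\<open>algebraically_dependent\<close>). Together they give
  \<open>krull_dim_le\<close>.

  For the lower bounds, the parameters of one chart are set free one after the other. The closures
  of the images form a chain of irreducible sets (\<open>krull_dim_ge\<close>); it is strict because for each
  new parameter there is a polynomial in the matrix entries that vanishes as long as this
  parameter is zero, but not afterwards (\<open>pencil_tuple_witness\<close>, \<open>line_tuple_witness\<close>).
\<close>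

section \<open>Polynomial functions\<close>

lemma poly_funs_uminus: "f \<in> poly_funs X \<Longrightarrow> (\<lambda>x. - f x) \<in> poly_funs X"
  using poly_funs.mult[OF poly_funs.const[of "-1"]] by force

lemma poly_funs_diff: "f \<in> poly_funs X \<Longrightarrow> g \<in> poly_funs X \<Longrightarrow> (\<lambda>x. f x - g x) \<in> poly_funs X"
  using poly_funs.add[OF _ poly_funs_uminus] by force

lemma poly_funs_sum:
  "finite I \<Longrightarrow> (\<And>i. i \<in> I \<Longrightarrow> f i \<in> poly_funs X) \<Longrightarrow> (\<lambda>x. \<Sum>i\<in>I. f i x) \<in> poly_funs X"
  by (induction I rule: finite_induct) (auto intro: poly_funs.intros)

lemma poly_funs_prod:
  "finite I \<Longrightarrow> (\<And>i. i \<in> I \<Longrightarrow> f i \<in> poly_funs X) \<Longrightarrow> (\<lambda>x. \<Prod>i\<in>I. f i x) \<in> poly_funs X"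
  by (induction I rule: finite_induct) (auto intro: poly_funs.intros)

lemma poly_funs_power: "f \<in> poly_funs X \<Longrightarrow> (\<lambda>x. f x ^ n) \<in> poly_funs X"
  by (induction n) (auto intro: poly_funs.intros)

lemma poly_funs_compose:
  assumes "f \<in> poly_funs X" and "\<And>x. x \<in> X \<Longrightarrow> (\<lambda>y. x (\<phi> y)) \<in> poly_funs Y"
  shows "(\<lambda>y. f (\<phi> y)) \<in> poly_funs Y"
  using assms(1) by induction (auto intro: poly_funs.intros assms(2))

text \<open>
  Points of affine \<open>n\<close>-space are sequences whose entries from \<open>n\<close> on are ignored; thus one type
  serves all dimensions.
\<close>

definition coords :: "nat \<Rightarrow> ((nat \<Rightarrow> 'k::field) \<Rightarrow> 'k) set" where
  "coords n = (\<lambda>l y. y l) ` {..<n}"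

lemma coords_in_poly_funs: "l < n \<Longrightarrow> (\<lambda>y. y l) \<in> poly_funs (coords n)"
  by (rule poly_funs.coord) (auto simp: coords_def)

lemma poly_funs_on_line:
  assumes "f \<in> poly_funs (coords n)"
  shows "\<exists>P. \<forall>s. f (\<lambda>l. x l + s * (y l - x l)) = poly P s"
  using assms
proof induction
  case (coord f)
  then obtain l where "f = (\<lambda>y. y l)" by (auto simp: coords_def)
  then show ?case by (intro exI[of _ "[:x l, y l - x l:]"]) (simp add: algebra_simps)
next
  case (const c)
  show ?case by (intro exI[of _ "[:c:]"]) simp
next
  case (add f g)
  then show ?case by (metis poly_add)
next
  case (mult f g)
  then show ?case by (metis poly_mult)
qed

section \<open>Irreducible sets\<close>

text \<open>The ring of polynomial functions on \<open>Z\<close> is an integral domain.\<close>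

definition irreducible_on :: "('v \<Rightarrow> 'k::field) set \<Rightarrow> 'v set \<Rightarrow> bool" where
  "irreducible_on X Z \<longleftrightarrow> Z \<noteq> {} \<and>
     (\<forall>f\<in>poly_funs X. \<forall>g\<in>poly_funs X. (\<forall>z\<in>Z. f z * g z = 0) \<longrightarrow>
        (\<forall>z\<in>Z. f z = 0) \<or> (\<forall>z\<in>Z. g z = 0))"

lemma irreducible_onD:
  assumes "irreducible_on X Z" "f \<in> poly_funs X" "g \<in> poly_funs X"
    and "\<And>z. z \<in> Z \<Longrightarrow> f z * g z = 0"
  shows "(\<forall>z\<in>Z. f z = 0) \<or> (\<forall>z\<in>Z. g z = 0)"
  using assms unfolding irreducible_on_def by blast

lemma irreducible_on_prod:
  assumes "irreducible_on X Z" "finite I" "\<And>i. i \<in> I \<Longrightarrow> f i \<in> poly_funs X"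
    and "\<And>z. z \<in> Z \<Longrightarrow> (\<Prod>i\<in>I. f i z) = 0"
  shows "\<exists>i\<in>I. \<forall>z\<in>Z. f i z = 0"
  using assms(2-4)
proof (induction I rule: finite_induct)
  case empty
  then show ?case using assms(1) by (auto simp: irreducible_on_def)
next
  case (insert i I)
  have "(\<forall>z\<in>Z. f i z = 0) \<or> (\<forall>z\<in>Z. (\<Prod>i\<in>I. f i z) = 0)"
    using insert.prems insert.hyps
    by (intro irreducible_onD[OF assms(1)] poly_funs_prod) auto
  then show ?case using insert.IH insert.prems by auto
qed

lemma closedin_subtopology_zariski:
  assumes "V \<subseteq> E"
  shows "closedin (subtopology (zariski E X) V) Z \<longleftrightarrow>
    (\<exists>F\<subseteq>poly_funs X. Z = {x \<in> V. \<forall>f\<in>F. f x = 0})"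
proof -
  have "zero_locus E F \<inter> V = {x \<in> V. \<forall>f\<in>F. f x = 0}" for F :: "('a \<Rightarrow> 'b) set"
    using assms by (auto simp: zero_locus_def)
  then show ?thesis by (auto simp: closedin_subtopology closedin_zariski)
qed

lemma irreducible_space_iff_irreducible_on:
  assumes "Z \<subseteq> E"
  shows "irreducible_space (subtopology (zariski E X) Z) \<longleftrightarrow> irreducible_on X Z"
proof -
  note cl = closedin_subtopology_zariski[OF assms]
  have top: "topspace (subtopology (zariski E X) Z) = Z" using assms by auto
  show ?thesis
  proof
    assume irr: "irreducible_space (subtopology (zariski E X) Z)"
    have "(\<forall>z\<in>Z. f z = 0) \<or> (\<forall>z\<in>Z. g z = 0)"
      if "f \<in> poly_funs X" "g \<in> poly_funs X" "\<forall>z\<in>Z. f z * g z = 0" for f g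
    proof -
      have "closedin (subtopology (zariski E X) Z) {z \<in> Z. f z = 0}"
        unfolding cl using that(1) by (intro exI[of _ "{f}"]) auto
      moreover have "closedin (subtopology (zariski E X) Z) {z \<in> Z. g z = 0}"
        unfolding cl using that(2) by (intro exI[of _ "{g}"]) auto
      moreover have "{z \<in> Z. f z = 0} \<union> {z \<in> Z. g z = 0} = Z" using that(3) by auto
      ultimately have "{z \<in> Z. f z = 0} = Z \<or> {z \<in> Z. g z = 0} = Z"
        using irr unfolding irreducible_space_def top by blast
      then show ?thesis by blast
    qed
    then show "irreducible_on X Z"
      using irr unfolding irreducible_space_def top irreducible_on_def by blast
  next
    assume irr: "irreducible_on X Z"
    have "A = Z \<or> B = Z"
      if A: "closedin (subtopology (zariski E X) Z) A"
        and B: "closedin (subtopology (zariski E X) Z) B" and AB: "A \<union> B = Z" for A B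
    proof (rule ccontr)
      assume neq: "\<not> (A = Z \<or> B = Z)"
      obtain F G where F: "F \<subseteq> poly_funs X" "A = {x \<in> Z. \<forall>f\<in>F. f x = 0}"
        and G: "G \<subseteq> poly_funs X" "B = {x \<in> Z. \<forall>f\<in>G. f x = 0}"
        using A B unfolding cl by auto
      obtain f x where f: "f \<in> F" "x \<in> Z" "f x \<noteq> 0" using neq F(2) by blast
      obtain g y where g: "g \<in> G" "y \<in> Z" "g y \<noteq> 0" using neq G(2) by blast
      have "f z * g z = 0" if "z \<in> Z" for z
        using that AB F(2) G(2) f(1) g(1) by auto
      then show False using irreducible_onD[OF irr, of f g] F(1) G(1) f g by blast
    qed
    moreover have "Z \<noteq> {}" using irr unfolding irreducible_on_def by simp
    ultimately show "irreducible_space (subtopology (zariski E X) Z)"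
      unfolding irreducible_space_def top by simp
  qed
qed

lemma infinite_UNIV_alg_closed: "infinite (UNIV :: 'k::alg_closed_field set)"
proof
  assume fin: "finite (UNIV :: 'k set)"
  define P where "P = (\<Prod>a\<in>(UNIV :: 'k set). [:-a, 1:]) + 1"
  have "degree (\<Prod>a\<in>(UNIV :: 'k set). [:-a, 1:]) = card (UNIV :: 'k set)"
    by (subst degree_prod_eq_sum_degree) auto
  then have "degree P > 0"
    unfolding P_def using fin by (subst degree_add_eq_left) (auto simp: card_gt_0_iff)
  then obtain x where "poly P x = 0" using alg_closed_imp_poly_has_root by blast
  moreover have "poly P x = 1"
    unfolding P_def using fin by (auto simp: poly_prod)
  ultimately show False by simp
qed

text \<open>
  Two points with nonzero values of \<open>f\<close> and \<open>g\<close> respectively are joined by a line, on which both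
  functions become nonzero polynomials in one variable; over an infinite field these have a common
  non-root.
\<close>

lemma irreducible_on_image:
  fixes \<phi> :: "(nat \<Rightarrow> 'k::field) \<Rightarrow> 'v"
  assumes inf: "infinite (UNIV :: 'k set)"
    and \<phi>: "\<And>x. x \<in> X \<Longrightarrow> (\<lambda>y. x (\<phi> y)) \<in> poly_funs (coords n)"
    and S: "S \<noteq> {}" "\<And>x y s. x \<in> S \<Longrightarrow> y \<in> S \<Longrightarrow> (\<lambda>l. x l + s * (y l - x l)) \<in> S"
  shows "irreducible_on X (\<phi> ` S)"
  unfolding irreducible_on_def
proof (intro conjI ballI impI)
  show "\<phi> ` S \<noteq> {}" using S(1) by simp
  fix f g assume fg: "f \<in> poly_funs X" "g \<in> poly_funs X" and 0: "\<forall>z\<in>\<phi> ` S. f z * g z = 0"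
  show "(\<forall>z\<in>\<phi> ` S. f z = 0) \<or> (\<forall>z\<in>\<phi> ` S. g z = 0)"
  proof (rule ccontr)
    assume "\<not> ?thesis"
    then obtain x y where x: "x \<in> S" "f (\<phi> x) \<noteq> 0" and y: "y \<in> S" "g (\<phi> y) \<noteq> 0" by auto
    let ?l = "\<lambda>s l. x l + s * (y l - x l)"
    have "\<exists>P. \<forall>s. f (\<phi> (?l s)) = poly P s"
      by (rule poly_funs_on_line[OF poly_funs_compose[OF fg(1) \<phi>]])
    then obtain P where P: "\<And>s. f (\<phi> (?l s)) = poly P s" by blast
    have "\<exists>Q. \<forall>s. g (\<phi> (?l s)) = poly Q s"
      by (rule poly_funs_on_line[OF poly_funs_compose[OF fg(2) \<phi>]])
    then obtain Q where Q: "\<And>s. g (\<phi> (?l s)) = poly Q s" by blast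
    have "P \<noteq> 0" using P[of 0] x by auto
    moreover have "Q \<noteq> 0" using Q[of 1] y by auto
    ultimately have fin: "finite {s. poly (P * Q) s = 0}" by (intro poly_roots_finite) simp
    have "poly (P * Q) s = 0" for s
    proof -
      have "\<phi> (?l s) \<in> \<phi> ` S" using S(2)[OF x(1) y(1)] by (rule imageI)
      then have "f (\<phi> (?l s)) * g (\<phi> (?l s)) = 0" using 0 by blast
      then show ?thesis by (simp only: P Q poly_mult)
    qed
    then have all: "{s. poly (P * Q) s = 0} = UNIV" by blast
    show False using fin inf unfolding all by simp
  qed
qed

section \<open>Lower bounds for the dimension\<close>

definition affine_sub :: "nat \<Rightarrow> (nat \<Rightarrow> 'k::field) set" where
  "affine_sub n = {y. \<forall>l\<ge>n. y l = 0}"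

lemma affine_sub_mono: "i \<le> j \<Longrightarrow> affine_sub i \<subseteq> affine_sub j"
  by (auto simp: affine_sub_def)

text \<open>
  The chain consists of the closures in \<open>V\<close> of the images of the coordinate subspaces
  \<open>affine_sub 0, \<dots>, affine_sub n\<close>. They inherit irreducibility from the images, and the witnesses
  separate consecutive members.
\<close>

lemma krull_dim_ge:
  fixes \<phi> :: "(nat \<Rightarrow> 'k::field) \<Rightarrow> 'v"
  assumes inf: "infinite (UNIV :: 'k set)" and VE: "V \<subseteq> E"
    and \<phi>: "\<And>x. x \<in> X \<Longrightarrow> (\<lambda>y. x (\<phi> y)) \<in> poly_funs (coords N)"
    and into: "\<phi> ` affine_sub n \<subseteq> V"
    and witness: "\<And>i. i < n \<Longrightarrow> \<exists>f\<in>poly_funs X.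
      (\<forall>y\<in>affine_sub i. f (\<phi> y) = 0) \<and> (\<exists>y\<in>affine_sub (Suc i). f (\<phi> y) \<noteq> 0)"
  shows "krull_dim (subtopology (zariski E X) V) \<ge> enat n"
proof -
  let ?I = "\<lambda>i. {f \<in> poly_funs X. \<forall>z\<in>\<phi> ` affine_sub i. f z = 0}"
  define Z where "Z i = {x \<in> V. \<forall>f\<in>?I i. f x = 0}" for i
  have sub: "\<phi> ` affine_sub i \<subseteq> Z i" if "i \<le> n" for i
    using into affine_sub_mono[OF that] unfolding Z_def by auto
  have "closedin (subtopology (zariski E X) V) (Z i)" for i
    unfolding closedin_subtopology_zariski[OF VE] Z_def by (intro exI[of _ "?I i"]) auto
  moreover have "irreducible_space (subtopology (subtopology (zariski E X) V) (Z i))" if "i \<le> n" for i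
  proof -
    have ZV: "Z i \<subseteq> V" unfolding Z_def by auto
    have van: "\<forall>z\<in>Z i. f z = 0" if "f \<in> poly_funs X" "\<forall>z\<in>\<phi> ` affine_sub i. f z = 0" for f
      using that unfolding Z_def by blast
    have "irreducible_on X (\<phi> ` affine_sub i)"
      by (rule irreducible_on_image[OF inf \<phi>]) (auto simp: affine_sub_def)
    note img = this
    have "Z i \<noteq> {}" using img sub[OF that] unfolding irreducible_on_def by blast
    moreover have "(\<forall>z\<in>Z i. f z = 0) \<or> (\<forall>z\<in>Z i. g z = 0)"
      if fg: "f \<in> poly_funs X" "g \<in> poly_funs X" "\<forall>z\<in>Z i. f z * g z = 0" for f g
    proof -
      have "f z * g z = 0" if "z \<in> \<phi> ` affine_sub i" for z
        using that fg(3) sub[OF \<open>i \<le> n\<close>] by blast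
      then show ?thesis using irreducible_onD[OF img fg(1,2)] van fg(1,2) by blast
    qed
    ultimately have "irreducible_on X (Z i)" unfolding irreducible_on_def by blast
    then show ?thesis
      using ZV VE
      by (simp add: subtopology_subtopology irreducible_space_iff_irreducible_on inf_absorb2)
  qed
  moreover have "Z i \<subset> Z (Suc i)" if i: "i < n" for i
  proof -
    have "\<phi> ` affine_sub i \<subseteq> \<phi> ` affine_sub (Suc i)"
      using affine_sub_mono[of i "Suc i"] by auto
    then have "Z i \<subseteq> Z (Suc i)" unfolding Z_def by blast
    moreover obtain f y where f: "f \<in> poly_funs X" "\<forall>y\<in>affine_sub i. f (\<phi> y) = 0"
      and y: "y \<in> affine_sub (Suc i)" "f (\<phi> y) \<noteq> 0" using witness[OF i] by blast
    have "\<phi> y \<in> Z (Suc i)" using sub[of "Suc i"] i y by auto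
    moreover have "\<phi> y \<notin> Z i" using f y unfolding Z_def by auto
    ultimately show ?thesis by blast
  qed
  ultimately show ?thesis unfolding krull_dim_def by (intro Sup_upper) blast
qed

section \<open>Algebraic independence along a chain\<close>

definition monom_fun :: "(nat \<Rightarrow> 'v \<Rightarrow> 'k::field) \<Rightarrow> nat \<Rightarrow> (nat \<Rightarrow> nat) \<Rightarrow> 'v \<Rightarrow> 'k" where
  "monom_fun f m \<beta> z = (\<Prod>l<m. f l z ^ \<beta> l)"

lemma poly_funs_monom_fun: "(\<And>l. l < m \<Longrightarrow> f l \<in> poly_funs X) \<Longrightarrow> monom_fun f m \<beta> \<in> poly_funs X"
  unfolding monom_fun_def[abs_def] by (intro poly_funs_prod poly_funs_power) auto

lemma sum_exponents_Suc:
  fixes h :: "(nat \<Rightarrow> nat) \<Rightarrow> 'a::comm_monoid_add"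
  shows "(\<Sum>\<beta>\<in>{..<Suc m} \<rightarrow>\<^sub>E {..d}. h \<beta>) = (\<Sum>j\<le>d. \<Sum>\<beta>\<in>{..<m} \<rightarrow>\<^sub>E {..d}. h (\<beta>(m := j)))"
proof -
  have "{..<Suc m} \<rightarrow>\<^sub>E {..d} = (\<lambda>(j, \<beta>). \<beta>(m := j)) ` ({..d} \<times> ({..<m} \<rightarrow>\<^sub>E {..d}))"
    unfolding lessThan_Suc by (rule PiE_insert_eq)
  moreover have "inj_on (\<lambda>(j, \<beta>). \<beta>(m := j)) ({..d} \<times> ({..<m} \<rightarrow>\<^sub>E {..d}))"
    by (rule inj_combinator) simp
  ultimately show ?thesis
    by (simp add: sum.reindex sum.cartesian_product case_prod_unfold)
qed

lemma monom_fun_upd: "monom_fun f (Suc m) (\<beta>(m := j)) z = monom_fun f m \<beta> z * f m z ^ j"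
  by (simp add: monom_fun_def)

text \<open>
  If \<open>f l\<close> vanishes on the \<open>l\<close>-th member of a chain of irreducible sets but not on the next one, then
  \<open>f 0, \<dots>, f (m - 1)\<close> are algebraically independent on the \<open>m\<close>-th member: given a relation, divide it by the
  largest possible power of the last function and restrict to the previous member, where the
  last function vanishes; what survives is a relation between the other functions.
\<close>

lemma chain_functions_independent:
  assumes irr: "\<And>i. i \<le> m \<Longrightarrow> irreducible_on X (Z i)"
    and mono: "\<And>i. i < m \<Longrightarrow> Z i \<subseteq> Z (Suc i)"
    and f: "\<And>l. l < m \<Longrightarrow> f l \<in> poly_funs X"
    and f0: "\<And>l z. l < m \<Longrightarrow> z \<in> Z l \<Longrightarrow> f l z = 0"
    and f1: "\<And>l. l < m \<Longrightarrow> \<exists>z\<in>Z (Suc l). f l z \<noteq> 0"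
    and rel: "\<And>z. z \<in> Z m \<Longrightarrow> (\<Sum>\<beta>\<in>{..<m} \<rightarrow>\<^sub>E {..d}. c \<beta> * monom_fun f m \<beta> z) = 0"
    and \<beta>: "\<beta> \<in> {..<m} \<rightarrow>\<^sub>E {..d}"
  shows "c \<beta> = 0"
  using assms
proof (induction m arbitrary: c \<beta>)
  case 0
  have "Z 0 \<noteq> {}" using "0.prems"(1)[of 0] unfolding irreducible_on_def by simp
  then obtain z where "z \<in> Z 0" by blast
  with "0.prems"(6)[OF this] "0.prems"(7) show ?case by (simp add: monom_fun_def)
next
  case (Suc m)
  let ?B = "{..<m} \<rightarrow>\<^sub>E {..d}"
  define H where "H j z = (\<Sum>\<beta>\<in>?B. c (\<beta>(m := j)) * monom_fun f m \<beta> z)" for j z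
  have fin: "finite ?B" by (intro finite_PiE) auto
  have H: "H j \<in> poly_funs X" for j
    unfolding H_def[abs_def]
    by (intro poly_funs_sum fin poly_funs.mult poly_funs.const poly_funs_monom_fun Suc.prems) auto
  have fm: "f m \<in> poly_funs X" by (rule Suc.prems) simp
  obtain z0 where z0: "z0 \<in> Z (Suc m)" "f m z0 \<noteq> 0" using Suc.prems(5)[of m] by auto
  have rel: "(\<Sum>j\<le>d. H j z * f m z ^ j) = 0" if "z \<in> Z (Suc m)" for z
    using Suc.prems(6)[OF that]
    by (simp add: sum_exponents_Suc monom_fun_upd H_def sum_distrib_right mult.assoc)
  have zero: "j \<le> d \<Longrightarrow> \<forall>\<beta>\<in>?B. c (\<beta>(m := j)) = 0" for j
  proof (induction j rule: less_induct)
    case (less j)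
    let ?q = "\<lambda>z. \<Sum>i\<in>{j..d}. H i z * f m z ^ (i - j)"
    have "f m z ^ j * ?q z = 0" if "z \<in> Z (Suc m)" for z
    proof -
      have "H i z = 0" if "i < j" for i
      proof -
        have "\<forall>\<beta>\<in>?B. c (\<beta>(m := i)) = 0" 
          by (rule less.IH[OF that]) (use that less.prems in simp)
        then show ?thesis unfolding H_def by (intro sum.neutral) auto
      qed
      then have "(\<Sum>i\<le>d. H i z * f m z ^ i) = (\<Sum>i\<in>{j..d}. H i z * f m z ^ i)"
        by (intro sum.mono_neutral_right) auto
      also have "\<dots> = f m z ^ j * ?q z"
        unfolding sum_distrib_left
        by (intro sum.cong refl) (simp add: algebra_simps flip: power_add)
      finally show ?thesis using rel[OF that] by simp
    qed
    then have "(\<forall>z\<in>Z (Suc m). f m z ^ j = 0) \<or> (\<forall>z\<in>Z (Suc m). ?q z = 0)"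
      by (intro irreducible_onD[OF Suc.prems(1)[of "Suc m"]] poly_funs_power poly_funs_sum
          poly_funs.mult fm H) auto
    then have q: "\<forall>z\<in>Z (Suc m). ?q z = 0" using z0 by auto
    have "H j z = 0" if z: "z \<in> Z m" for z
    proof -
      have "f m z = 0" using Suc.prems(4)[of m] z by simp
      then have "?q z = (\<Sum>i\<in>{j..d}. if i = j then H j z else 0)"
        by (intro sum.cong) auto
      also have "\<dots> = H j z" using less.prems by simp
      finally show ?thesis using q z Suc.prems(2)[of m] by auto
    qed
    then have rel': "(\<Sum>\<beta>\<in>?B. c (\<beta>(m := j)) * monom_fun f m \<beta> z) = 0" if "z \<in> Z m" for z
      using that unfolding H_def by blast
    show ?case
    proof
      fix \<beta> assume \<beta>: "\<beta> \<in> ?B"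
      show "c (\<beta>(m := j)) = 0"
        by (rule Suc.IH[where c = "\<lambda>\<beta>. c (\<beta>(m := j))"])
          (fact Suc.prems(1)[OF le_SucI] Suc.prems(2-5)[OF less_SucI] rel' \<beta>)+
    qed
  qed
  have "\<beta> \<in> insert m {..<m} \<rightarrow>\<^sub>E {..d}" using Suc.prems(7) by (simp add: lessThan_Suc)
  then obtain j \<beta>' where "j \<le> d" "\<beta>' \<in> ?B" "\<beta> = \<beta>'(m := j)"
    unfolding PiE_insert_eq by auto
  with zero show ?case by blast
qed

section \<open>Upper bounds for the dimension\<close>

lemma homogeneous_system_nontrivial_solution:
  fixes A :: "'b \<Rightarrow> 'i \<Rightarrow> 'k::field"
  assumes "finite B" "finite I" "card B < card I"
  shows "\<exists>c. (\<exists>i\<in>I. c i \<noteq> 0) \<and> (\<forall>b\<in>B. (\<Sum>i\<in>I. A b i * c i) = 0)"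
  using assms
proof (induction B arbitrary: I A rule: finite_induct)
  case empty
  then obtain i where "i \<in> I" by fastforce
  then show ?case by (intro exI[of _ "\<lambda>_. 1"]) auto
next
  case (insert b B)
  show ?case
  proof (cases "\<forall>i\<in>I. A b i = 0")
    case True
    obtain c where "\<exists>i\<in>I. c i \<noteq> 0" "\<forall>b\<in>B. (\<Sum>i\<in>I. A b i * c i) = 0"
      using insert.IH[of I A] insert.prems insert.hyps by auto
    then show ?thesis using True by (intro exI[of _ c]) auto
  next
    case False
    then obtain k where k: "k \<in> I" "A b k \<noteq> 0" by blast
    let ?I = "I - {k}"
    \<comment> \<open>Equation \<open>b\<close> eliminates the unknown \<open>k\<close> from the other equations.\<close>
    let ?A = "\<lambda>b' i. A b' i - A b' k * A b i / A b k"
    obtain c where c: "\<exists>i\<in>?I. c i \<noteq> 0" "\<forall>b'\<in>B. (\<Sum>i\<in>?I. ?A b' i * c i) = 0"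
    proof -
      have "card B < card ?I" using insert.prems insert.hyps k by simp
      then show ?thesis using insert.IH[of ?I ?A] insert.prems(1) that by blast
    qed
    define ck where "ck = - (\<Sum>i\<in>?I. A b i * c i) / A b k"
    define c' where "c' = c(k := ck)"
    have split: "(\<Sum>i\<in>I. A b' i * c' i) = A b' k * ck + (\<Sum>i\<in>?I. A b' i * c i)" for b'
    proof -
      have "(\<Sum>i\<in>I. A b' i * c' i) = A b' k * c' k + (\<Sum>i\<in>?I. A b' i * c' i)"
        using k insert.prems(1) by (simp add: sum.remove)
      also have "(\<Sum>i\<in>?I. A b' i * c' i) = (\<Sum>i\<in>?I. A b' i * c i)"
        by (intro sum.cong) (auto simp: c'_def)
      finally show ?thesis by (simp add: c'_def)
    qed
    have "(\<Sum>i\<in>I. A b i * c' i) = 0" unfolding split ck_def using k by simp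
    moreover have "(\<Sum>i\<in>I. A b' i * c' i) = 0" if "b' \<in> B" for b'
    proof -
      have "(\<Sum>i\<in>?I. ?A b' i * c i)
          = (\<Sum>i\<in>?I. A b' i * c i) - (A b' k / A b k) * (\<Sum>i\<in>?I. A b i * c i)"
        unfolding sum_distrib_left sum_subtractf[symmetric]
        by (intro sum.cong refl) (simp add: algebra_simps)
      then show ?thesis unfolding split ck_def using c(2) that by simp
    qed
    moreover have "\<exists>i\<in>I. c' i \<noteq> 0" using c(1) by (auto simp: c'_def)
    ultimately show ?thesis by (intro exI[of _ c']) auto
  qed
qed

text \<open>Polynomial functions in \<open>n\<close> variables whose degree in each variable is at most \<open>D\<close>.\<close>

definition box_funs :: "nat \<Rightarrow> nat \<Rightarrow> ((nat \<Rightarrow> 'k::field) \<Rightarrow> 'k) set" where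
  "box_funs n D = {f. \<exists>c. \<forall>y. f y =
     (\<Sum>\<beta>\<in>{..<n} \<rightarrow>\<^sub>E {..D}. c \<beta> * monom_fun (\<lambda>l y. y l) n \<beta> y)}"

lemma box_funs_monom:
  assumes "\<beta> \<in> {..<n} \<rightarrow> {..D}"
  shows "monom_fun (\<lambda>l y. y l) n \<beta> \<in> box_funs n D"
proof -
  let ?\<beta> = "restrict \<beta> {..<n}"
  let ?m = "\<lambda>\<beta> (y :: nat \<Rightarrow> 'a). monom_fun (\<lambda>l y. y l) n \<beta> y"
  have fin: "finite ({..<n} \<rightarrow>\<^sub>E {..D})" by (intro finite_PiE) auto
  have "?m \<beta> y = (\<Sum>\<gamma>\<in>{..<n} \<rightarrow>\<^sub>E {..D}. (if \<gamma> = ?\<beta> then 1 else 0) * ?m \<gamma> y)" for y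
  proof -
    have "(\<Sum>\<gamma>\<in>{..<n} \<rightarrow>\<^sub>E {..D}. (if \<gamma> = ?\<beta> then 1 else 0) * ?m \<gamma> y) =
        (\<Sum>\<gamma>\<in>{..<n} \<rightarrow>\<^sub>E {..D}. if \<gamma> = ?\<beta> then ?m ?\<beta> y else 0)"
      by (intro sum.cong) auto
    also have "\<dots> = ?m ?\<beta> y" using fin assms by simp
    also have "\<dots> = ?m \<beta> y" by (simp add: monom_fun_def)
    finally show ?thesis by simp
  qed
  then show ?thesis
    unfolding box_funs_def by (intro CollectI exI[of _ "\<lambda>\<gamma>. if \<gamma> = ?\<beta> then 1 else 0"] allI)
qed

lemma box_funs_add: "f \<in> box_funs n D \<Longrightarrow> g \<in> box_funs n D \<Longrightarrow> (\<lambda>y. f y + g y) \<in> box_funs n D"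
  unfolding box_funs_def
  apply clarsimp
  subgoal for c c' by (intro exI[of _ "\<lambda>\<beta>. c \<beta> + c' \<beta>"]) (simp add: algebra_simps sum.distrib)
  done

lemma box_funs_scale: "f \<in> box_funs n D \<Longrightarrow> (\<lambda>y. a * f y) \<in> box_funs n D"
  unfolding box_funs_def
  apply clarsimp
  subgoal for c by (intro exI[of _ "\<lambda>\<beta>. a * c \<beta>"]) (simp add: algebra_simps sum_distrib_left)
  done

lemma box_funs_sum:
  "finite I \<Longrightarrow> (\<And>i. i \<in> I \<Longrightarrow> f i \<in> box_funs n D) \<Longrightarrow> (\<lambda>y. \<Sum>i\<in>I. f i y) \<in> box_funs n D"
proof (induction I rule: finite_induct)
  case empty
  show ?case by (auto simp: box_funs_def intro: exI[of _ "\<lambda>_. 0"])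
qed (simp add: box_funs_add)

lemma box_funs_mult:
  assumes "f \<in> box_funs n D" "g \<in> box_funs n D'"
  shows "(\<lambda>y. f y * g y) \<in> box_funs n (D + D')"
proof -
  let ?m = "\<lambda>\<beta>. monom_fun (\<lambda>l y. y l) n \<beta>"
  obtain c where c: "\<And>y. f y = (\<Sum>\<beta>\<in>{..<n} \<rightarrow>\<^sub>E {..D}. c \<beta> * ?m \<beta> y)"
    using assms(1) unfolding box_funs_def by blast
  obtain c' where c': "\<And>y. g y = (\<Sum>\<beta>\<in>{..<n} \<rightarrow>\<^sub>E {..D'}. c' \<beta> * ?m \<beta> y)"
    using assms(2) unfolding box_funs_def by blast
  have eq: "f y * g y = (\<Sum>\<beta>\<in>{..<n} \<rightarrow>\<^sub>E {..D}. \<Sum>\<beta>'\<in>{..<n} \<rightarrow>\<^sub>E {..D'}.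
      (c \<beta> * c' \<beta>') * ?m (\<lambda>l. \<beta> l + \<beta>' l) y)" for y
    unfolding c c' sum_product
    by (intro sum.cong refl) (simp add: monom_fun_def power_add prod.distrib)
  show ?thesis
    unfolding eq
    by (intro box_funs_sum box_funs_scale box_funs_monom finite_PiE)
      (auto dest!: PiE_mem intro!: add_mono)
qed

lemma box_funs_mono: "f \<in> box_funs n D \<Longrightarrow> D \<le> D' \<Longrightarrow> f \<in> box_funs n D'"
proof -
  assume "f \<in> box_funs n D" "D \<le> D'"
  then obtain c where c: "f = (\<lambda>y. \<Sum>\<beta>\<in>{..<n} \<rightarrow>\<^sub>E {..D}. c \<beta> * monom_fun (\<lambda>l y. y l) n \<beta> y)"
    unfolding box_funs_def by blast
  show ?thesis
    unfolding c using \<open>D \<le> D'\<close>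
    by (intro box_funs_sum box_funs_scale box_funs_monom finite_PiE)
      (auto dest!: PiE_mem intro: order_trans)
qed

lemma box_funs_const: "(\<lambda>_. a) \<in> box_funs n D"
  using box_funs_scale[OF box_funs_monom[of "\<lambda>_. 0" n D], of a] by (simp add: monom_fun_def)

lemma poly_funs_in_box: "f \<in> poly_funs (coords n) \<Longrightarrow> \<exists>D. f \<in> box_funs n D"
proof (induction rule: poly_funs.induct)
  case (coord f)
  then obtain l where l: "l < n" "f = (\<lambda>y. y l)" by (auto simp: coords_def)
  have "monom_fun (\<lambda>l y. y l) n (\<lambda>i. if i = l then 1 else 0) y = y l" for y :: "nat \<Rightarrow> 'a"
    using l(1) by (simp add: monom_fun_def if_distrib[where f = "\<lambda>e. _ ^ e"] cong: if_cong)
  then have "monom_fun (\<lambda>l y. y l) n (\<lambda>i. if i = l then 1 else 0) = f"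
    unfolding l by (intro ext) simp
  then show ?case
    using box_funs_monom[of "\<lambda>i. if i = l then 1 else 0" n 1] by auto
next
  case (const c)
  show ?case using box_funs_const by blast
next
  case (add f g)
  then obtain D D' where "f \<in> box_funs n D" "g \<in> box_funs n D'" by blast
  then show ?case
    by (intro exI[of _ "max D D'"] box_funs_add) (auto intro: box_funs_mono)
next
  case (mult f g)
  then show ?case using box_funs_mult by blast
qed

lemma box_funs_power: "f \<in> box_funs n D \<Longrightarrow> (\<lambda>y. f y ^ e) \<in> box_funs n (e * D)"
  by (induction e) (auto intro: box_funs_const box_funs_mult)

lemma box_funs_monom_fun:
  assumes "\<And>l. l < m \<Longrightarrow> F l \<in> box_funs n D" "\<beta> \<in> {..<m} \<rightarrow> {..d}"
  shows "monom_fun F m \<beta> \<in> box_funs n (m * d * D)"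
  using assms
proof (induction m)
  case 0
  then show ?case using box_funs_const[of 1] by (simp add: monom_fun_def[abs_def])
next
  case (Suc m)
  have "(\<lambda>y. F m y ^ \<beta> m) \<in> box_funs n (\<beta> m * D)" using Suc.prems by (intro box_funs_power) auto
  moreover have "\<beta> m * D \<le> d * D" using Suc.prems(2) by auto
  ultimately have "(\<lambda>y. F m y ^ \<beta> m) \<in> box_funs n (d * D)" by (rule box_funs_mono)
  moreover have "monom_fun F m \<beta> \<in> box_funs n (m * d * D)"
    using Suc.prems by (intro Suc.IH) auto
  ultimately have "(\<lambda>y. monom_fun F m \<beta> y * F m y ^ \<beta> m) \<in> box_funs n (m * d * D + d * D)"
    by (intro box_funs_mult)
  then show ?case by (simp add: monom_fun_def[abs_def] algebra_simps)
qed

text \<open>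
  More than \<open>n\<close> polynomials in \<open>n\<close> variables are algebraically dependent: there are \<open>(d + 1) ^ m\<close>
  monomials with exponents at most \<open>d\<close> in \<open>m\<close> polynomials, and they lie in a space of dimension
  at most \<open>(m d D + 1) ^ n\<close>, which is smaller if \<open>m > n\<close> and \<open>d\<close> is large.
\<close>

lemma algebraically_dependent:
  fixes F :: "nat \<Rightarrow> (nat \<Rightarrow> 'k::field) \<Rightarrow> 'k"
  assumes F: "\<And>l. l < m \<Longrightarrow> F l \<in> box_funs n D" and d: "(m * d * D + 1) ^ n < (d + 1) ^ m"
  shows "\<exists>c. (\<exists>\<beta>\<in>{..<m} \<rightarrow>\<^sub>E {..d}. c \<beta> \<noteq> 0) \<and>
    (\<forall>y. (\<Sum>\<beta>\<in>{..<m} \<rightarrow>\<^sub>E {..d}. c \<beta> * monom_fun F m \<beta> y) = 0)"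
proof -
  let ?I = "{..<m} \<rightarrow>\<^sub>E {..d}" and ?B = "{..<n} \<rightarrow>\<^sub>E {..m * d * D}"
  let ?m = "monom_fun (\<lambda>l y :: nat \<Rightarrow> 'k. y l) n"
  have "\<forall>\<beta>\<in>?I. \<exists>A. \<forall>y. monom_fun F m \<beta> y = (\<Sum>b\<in>?B. A b * ?m b y)"
  proof
    fix \<beta> assume "\<beta> \<in> ?I"
    then have "monom_fun F m \<beta> \<in> box_funs n (m * d * D)"
      by (intro box_funs_monom_fun F) auto
    then show "\<exists>A. \<forall>y. monom_fun F m \<beta> y = (\<Sum>b\<in>?B. A b * ?m b y)"
      unfolding box_funs_def by blast
  qed
  then obtain A where A: "\<And>\<beta> y. \<beta> \<in> ?I \<Longrightarrow> monom_fun F m \<beta> y = (\<Sum>b\<in>?B. A \<beta> b * ?m b y)"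
    by (auto dest!: bchoice)
  have fin: "finite ?B" "finite ?I" by (auto intro!: finite_PiE)
  have "card ?B < card ?I" using d by (simp add: card_funcsetE)
  from homogeneous_system_nontrivial_solution[OF fin this, where A = "\<lambda>b \<beta>. A \<beta> b"]
  obtain c where c: "\<exists>\<beta>\<in>?I. c \<beta> \<noteq> 0" "\<forall>b\<in>?B. (\<Sum>\<beta>\<in>?I. A \<beta> b * c \<beta>) = 0"
    by (elim exE conjE)
  have "(\<Sum>\<beta>\<in>?I. c \<beta> * monom_fun F m \<beta> y) = 0" for y
  proof -
    have "(\<Sum>\<beta>\<in>?I. c \<beta> * monom_fun F m \<beta> y) = (\<Sum>\<beta>\<in>?I. \<Sum>b\<in>?B. A \<beta> b * c \<beta> * ?m b y)"
      by (intro sum.cong refl) (simp add: A sum_distrib_left mult_ac)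
    also have "\<dots> = (\<Sum>b\<in>?B. (\<Sum>\<beta>\<in>?I. A \<beta> b * c \<beta>) * ?m b y)"
      by (subst sum.swap) (simp add: sum_distrib_right)
    finally show ?thesis using c(2) by simp
  qed
  then show ?thesis using c(1) by blast
qed

lemma exponent_bound_exists:
  fixes m n D :: nat
  assumes "n < m"
  shows "\<exists>d. (m * d * D + 1) ^ n < (d + 1) ^ m"
proof -
  define C where "C = m * D + 1"
  let ?d = "C ^ n"
  have "m * ?d * D + 1 \<le> C * (?d + 1)" by (simp add: C_def algebra_simps)
  then have "(m * ?d * D + 1) ^ n \<le> (C * (?d + 1)) ^ n" by (rule power_mono) simp
  also have "\<dots> = C ^ n * (?d + 1) ^ n" by (rule power_mult_distrib)
  also have "\<dots> < (?d + 1) * (?d + 1) ^ n" by simp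
  also have "\<dots> = (?d + 1) ^ Suc n" by simp
  also have "\<dots> \<le> (?d + 1) ^ m" using assms by (intro power_increasing) auto
  finally show ?thesis by blast
qed

text \<open>
  Functions witnessing a chain of length \<open>m > n\<close> satisfy an algebraic relation on each of the
  finitely many images. The product of these relations vanishes on the top member of the
  chain, so one of the factors does, against the independence of the functions there.
\<close>

lemma krull_dim_le:
  fixes \<Phi> :: "((nat \<Rightarrow> 'k::field) \<Rightarrow> 'v) set"
  assumes VE: "V \<subseteq> E" and fin: "finite \<Phi>" and cover: "V \<subseteq> (\<Union>\<phi>\<in>\<Phi>. range \<phi>)"
    and \<Phi>: "\<And>\<phi> x. \<phi> \<in> \<Phi> \<Longrightarrow> x \<in> X \<Longrightarrow> (\<lambda>y. x (\<phi> y)) \<in> poly_funs (coords n)"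
  shows "krull_dim (subtopology (zariski E X) V) \<le> enat n"
  unfolding krull_dim_def
proof (rule Sup_least, clarsimp)
  fix m Z
  assume Z: "\<forall>i\<le>m. closedin (subtopology (zariski E X) V) (Z i) \<and>
      irreducible_space (subtopology (subtopology (zariski E X) V) (Z i))"
    and lt: "\<forall>i<m. Z i \<subset> Z (Suc i)"
  have ZV: "Z i \<subseteq> V" if "i \<le> m" for i
    using Z that closedin_subset by fastforce
  have irr: "irreducible_on X (Z i)" if "i \<le> m" for i
  proof -
    have "irreducible_space (subtopology (zariski E X) (V \<inter> Z i))"
      using Z that by (simp add: subtopology_subtopology)
    moreover have "V \<inter> Z i = Z i" using ZV[OF that] by blast
    ultimately show ?thesis
      using ZV[OF that] VE irreducible_space_iff_irreducible_on[of "Z i" E X] by auto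
  qed
  define W where "W l g \<longleftrightarrow> g \<in> poly_funs X \<and> (\<forall>z\<in>Z l. g z = 0) \<and> (\<exists>z\<in>Z (Suc l). g z \<noteq> 0)"
    for l g
  have "\<exists>g. W l g" if "l < m" for l
  proof -
    have "closedin (subtopology (zariski E X) V) (Z l)" using Z that by simp
    then have "\<exists>F\<subseteq>poly_funs X. Z l = {x \<in> V. \<forall>f\<in>F. f x = 0}"
      unfolding closedin_subtopology_zariski[OF VE] .
    then obtain F where F: "F \<subseteq> poly_funs X" "Z l = {x \<in> V. \<forall>f\<in>F. f x = 0}"
      by (elim exE conjE)
    have "Z l \<subset> Z (Suc l)" using lt that by simp
    then obtain z where z: "z \<in> Z (Suc l)" "z \<notin> Z l" by (elim psubsetE) blast
    have "z \<in> V" using z ZV[of "Suc l"] that by auto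
    then obtain g where g: "g \<in> F" "g z \<noteq> 0" using z F(2) by auto
    then have "W l g" using F z(1) unfolding W_def by auto
    then show ?thesis by (rule exI[of "W l"])
  qed
  then have "\<forall>l\<in>{..<m}. \<exists>g. W l g" by simp
  from bchoice[OF this] obtain f where "\<forall>l\<in>{..<m}. W l (f l)" ..
  then have W: "\<And>l. l < m \<Longrightarrow> W l (f l)" by simp
  have f: "\<And>l. l < m \<Longrightarrow> f l \<in> poly_funs X"
    "\<And>l z. l < m \<Longrightarrow> z \<in> Z l \<Longrightarrow> f l z = 0" "\<And>l. l < m \<Longrightarrow> \<exists>z\<in>Z (Suc l). f l z \<noteq> 0"
    using W unfolding W_def by auto
  show "m \<le> n"
  proof (rule ccontr)
    assume "\<not> m \<le> n"
    then have nm: "n < m" by simp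
    have "\<exists>D. \<forall>\<phi>\<in>\<Phi>. \<forall>l<m. (\<lambda>y. f l (\<phi> y)) \<in> box_funs n D"
    proof -
      have "\<forall>p\<in>\<Phi> \<times> {..<m}. \<exists>D. (\<lambda>y. f (snd p) (fst p y)) \<in> box_funs n D"
        by (auto intro!: poly_funs_in_box poly_funs_compose[OF f(1) \<Phi>])
      from bchoice[OF this] obtain D
        where D: "\<forall>p\<in>\<Phi> \<times> {..<m}. (\<lambda>y. f (snd p) (fst p y)) \<in> box_funs n (D p)" ..
      have "D p \<le> sum D (\<Phi> \<times> {..<m})" if "p \<in> \<Phi> \<times> {..<m}" for p
        using that fin by (intro member_le_sum) auto
      then have "(\<lambda>y. f (snd p) (fst p y)) \<in> box_funs n (sum D (\<Phi> \<times> {..<m}))"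
        if "p \<in> \<Phi> \<times> {..<m}" for p
        using that by (intro box_funs_mono[OF D[rule_format]]) auto
      then show ?thesis by fastforce
    qed
    then obtain D where D: "\<And>\<phi> l. \<phi> \<in> \<Phi> \<Longrightarrow> l < m \<Longrightarrow> (\<lambda>y. f l (\<phi> y)) \<in> box_funs n D" by blast
    obtain d where d: "(m * d * D + 1) ^ n < (d + 1) ^ m" using exponent_bound_exists[OF nm] by blast
    let ?I = "{..<m} \<rightarrow>\<^sub>E {..d}"
    have mon: "monom_fun (\<lambda>l y. f l (\<phi> y)) m \<beta> y = monom_fun f m \<beta> (\<phi> y)"
      for \<phi> :: "(nat \<Rightarrow> 'k) \<Rightarrow> 'v" and \<beta> y
      by (simp add: monom_fun_def)
    have "\<forall>\<phi>\<in>\<Phi>. \<exists>c. (\<exists>\<beta>\<in>?I. c \<beta> \<noteq> 0) \<and> (\<forall>y. (\<Sum>\<beta>\<in>?I. c \<beta> * monom_fun f m \<beta> (\<phi> y)) = 0)"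
    proof
      fix \<phi> assume "\<phi> \<in> \<Phi>"
      then show "\<exists>c. (\<exists>\<beta>\<in>?I. c \<beta> \<noteq> 0) \<and> (\<forall>y. (\<Sum>\<beta>\<in>?I. c \<beta> * monom_fun f m \<beta> (\<phi> y)) = 0)"
        by (intro algebraically_dependent[of m "\<lambda>l y. f l (\<phi> y)" n D d, unfolded mon] D d)
    qed
    from bchoice[OF this] obtain c
      where c0: "\<forall>\<phi>\<in>\<Phi>. (\<exists>\<beta>\<in>?I. c \<phi> \<beta> \<noteq> 0) \<and> (\<forall>y. (\<Sum>\<beta>\<in>?I. c \<phi> \<beta> * monom_fun f m \<beta> (\<phi> y)) = 0)" ..
    have c: "\<exists>\<beta>\<in>?I. c \<phi> \<beta> \<noteq> 0" "(\<Sum>\<beta>\<in>?I. c \<phi> \<beta> * monom_fun f m \<beta> (\<phi> y)) = 0"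
      if "\<phi> \<in> \<Phi>" for \<phi> y
      using bspec[OF c0 that] by simp_all
    let ?R = "\<lambda>\<phi> z. \<Sum>\<beta>\<in>?I. c \<phi> \<beta> * monom_fun f m \<beta> z"
    have "(\<Prod>\<phi>\<in>\<Phi>. ?R \<phi> z) = 0" if z: "z \<in> Z m" for z
    proof -
      obtain \<phi> y where "\<phi> \<in> \<Phi>" "z = \<phi> y" using z ZV[of m] cover by auto
      then have "?R \<phi> z = 0" using c(2) by simp
      then show ?thesis using fin \<open>\<phi> \<in> \<Phi>\<close> by (intro prod_zero bexI)
    qed
    then have "\<exists>\<phi>\<in>\<Phi>. \<forall>z\<in>Z m. ?R \<phi> z = 0"
      by (intro irreducible_on_prod[OF irr] fin poly_funs_sum poly_funs.mult poly_funs.const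
          poly_funs_monom_fun f finite_PiE) auto
    then obtain \<phi> where \<phi>: "\<phi> \<in> \<Phi>" "\<And>z. z \<in> Z m \<Longrightarrow> ?R \<phi> z = 0" by blast
    have "c \<phi> \<beta> = 0" if "\<beta> \<in> ?I" for \<beta>
    proof (rule chain_functions_independent[where c = "c \<phi>" and \<beta> = \<beta>])
      show "Z i \<subseteq> Z (Suc i)" if "i < m" for i using lt that by blast
    qed (fact irr f \<phi>(2) that)+
    then show False using c(1)[OF \<phi>(1)] by blast
  qed
qed

section \<open>Common flags of commuting nilpotent matrices\<close>

text \<open>
  The last nonzero iterate of \<open>s\<close> under one of the maps lies in the kernel of that map, and the
  other maps preserve this kernel, so the number of maps can be reduced by one. With \<open>S\<close> an
  invariant subspace, the lemma yields kernel vectors inside that subspace.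
\<close>

lemma common_kernel:
  fixes F :: "nat \<Rightarrow> 'a \<Rightarrow> 'a"
  assumes "s \<in> S" "s \<noteq> z"
    and "\<And>n v. n < r \<Longrightarrow> v \<in> S \<Longrightarrow> F n v \<in> S"
    and "\<And>m n v. m < r \<Longrightarrow> n < r \<Longrightarrow> v \<in> S \<Longrightarrow> F m (F n v) = F n (F m v)"
    and "\<And>n v. n < r \<Longrightarrow> v \<in> S \<Longrightarrow> \<exists>q. (F n ^^ q) v = z"
    and "\<And>n. n < r \<Longrightarrow> F n z = z"
  shows "\<exists>v\<in>S. v \<noteq> z \<and> (\<forall>n<r. F n v = z)"
  using assms
proof (induction r arbitrary: S s)
  case 0
  then show ?case by auto
next
  case (Suc r)
  let ?S = "{v \<in> S. F r v = z}"
  obtain q where q: "(F r ^^ q) s = z" using Suc.prems(5)[of r s] Suc.prems(1) by auto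
  define p where "p = (LEAST q. (F r ^^ q) s = z)"
  have p: "(F r ^^ p) s = z" unfolding p_def using q by (rule LeastI)
  have "p \<noteq> 0" using p Suc.prems(2) by (intro notI) simp
  then obtain p' where p': "p = Suc p'" by (cases p) auto
  have ne: "(F r ^^ p') s \<noteq> z" using not_less_Least[of p' "\<lambda>q. (F r ^^ q) s = z"] p' p_def by simp
  have "(F r ^^ e) s \<in> S" for e
    by (induction e) (use Suc.prems(1,3) in auto)
  then have "(F r ^^ p') s \<in> ?S" using p p' by simp
  then have "\<exists>v\<in>?S. v \<noteq> z \<and> (\<forall>n<r. F n v = z)"
  proof (rule Suc.IH)
    show "F n v \<in> ?S" if "n < r" "v \<in> ?S" for n v
    proof -
      have "F r (F n v) = F n (F r v)" using Suc.prems(4)[of r n v] that by simp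
      also have "\<dots> = z" using that Suc.prems(6)[of n] by simp
      finally show ?thesis using that Suc.prems(3)[of n v] by simp
    qed
    show "F m (F n v) = F n (F m v)" if "m < r" "n < r" "v \<in> ?S" for m n v
      using that Suc.prems(4)[of m n v] by simp
    show "\<exists>q. (F n ^^ q) v = z" if "n < r" "v \<in> ?S" for n v
      using that Suc.prems(5)[of n v] by simp
    show "F n z = z" if "n < r" for n using that Suc.prems(6)[of n] by simp
  qed (use ne in simp)
  then show ?case by (auto simp: less_Suc_eq)
qed

text \<open>
  The matrix \<open>a v f\<^sub>1 + c v f\<^sub>2 + b v' f\<^sub>2\<close>, where \<open>v = (1, u, t)\<close> and \<open>v' = (0, 1, m)\<close> in the coordinates
  \<open>i, j, k\<close>, and where \<open>f\<^sub>0, f\<^sub>1, f\<^sub>2\<close> is the basis dual to \<open>v, v', e\<^sub>k\<close>. These are the matrices that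
  are strictly upper triangular with entries \<open>a, b, c\<close> with respect to that basis.
\<close>

definition flag_mat ::
  "3 \<Rightarrow> 3 \<Rightarrow> 3 \<Rightarrow> 'k \<Rightarrow> 'k \<Rightarrow> 'k \<Rightarrow> 'k \<Rightarrow> 'k \<Rightarrow> 'k \<Rightarrow> 'k::field ^ 3 ^ 3" where
  "flag_mat i j k u t m a b c = (\<chi> p q.
     (if p = i then 1 else if p = j then u else t) *
       (a * (if q = i then - u else if q = j then 1 else 0) +
        c * (if q = i then u * m - t else if q = j then - m else 1)) +
     (if p = i then 0 else if p = j then 1 else m) * b *
       (if q = i then u * m - t else if q = j then - m else 1))"

lemma sum_distinct_3:
  fixes i j k :: 3
  assumes "i \<noteq> j" "j \<noteq> k" "i \<noteq> k"
  shows "sum f UNIV = f i + f j + f k" and "p = i \<or> p = j \<or> p = k"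
proof -
  have "card {i, j, k} = CARD(3)" using assms by simp
  then have eq: "UNIV = {i, j, k}" by (metis card_subset_eq finite_UNIV subset_UNIV finite_code)
  show "sum f UNIV = f i + f j + f k" unfolding eq using assms by (simp add: add.assoc)
  show "p = i \<or> p = j \<or> p = k" using eq by blast
qed

text \<open>
  Of the forms \<open>f\<^sub>1, f\<^sub>2\<close> on the vectors \<open>v, v'\<close> only \<open>f\<^sub>1 v' = 1\<close> is nonzero, so that of all
  products only \<open>(v f\<^sub>1) (v' f\<^sub>2) = v f\<^sub>2\<close> survives.
\<close>

lemma flag_mat_mult:
  assumes "i \<noteq> j" "j \<noteq> k" "i \<noteq> k"
  shows "flag_mat i j k u t m a b c ** flag_mat i j k u t m a' b' c' =
    flag_mat i j k u t m 0 0 (a * b')"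
proof -
  have "(flag_mat i j k u t m a b c ** flag_mat i j k u t m a' b' c') $ p $ q =
    flag_mat i j k u t m 0 0 (a * b') $ p $ q" for p q
    using sum_distinct_3(2)[OF assms, of p] sum_distinct_3(2)[OF assms, of q] assms
    by (auto simp: matrix_matrix_mult_def sum_distinct_3(1)[OF assms] flag_mat_def algebra_simps)
  then show ?thesis by (simp add: vec_eq_iff)
qed

lemma flag_mat_trace:
  assumes "i \<noteq> j" "j \<noteq> k" "i \<noteq> k"
  shows "trace (flag_mat i j k u t m a b c) = 0"
  using assms by (simp add: trace_def sum_distinct_3(1)[OF assms] flag_mat_def algebra_simps)

lemma flag_mat_corner_eq_iff:
  assumes "i \<noteq> j" "j \<noteq> k" "i \<noteq> k"
  shows "flag_mat i j k u t m 0 0 c = flag_mat i j k u t m 0 0 c' \<longleftrightarrow> c = c'"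
proof
  assume "flag_mat i j k u t m 0 0 c = flag_mat i j k u t m 0 0 c'"
  then have "flag_mat i j k u t m 0 0 c $ i $ k = flag_mat i j k u t m 0 0 c' $ i $ k" by simp
  then show "c = c'" using assms by (simp add: flag_mat_def)
qed simp

lemma flag_mat_zero: "flag_mat i j k u t m 0 0 0 = 0"
  by (simp add: flag_mat_def vec_eq_iff)

lemma lie_flag_mat:
  assumes "i \<noteq> j" "j \<noteq> k" "i \<noteq> k"
  shows "lie (flag_mat i j k u t m a b c) (flag_mat i j k u t m a' b' c') = 0 \<longleftrightarrow> a * b' = a' * b"
  by (simp add: lie_def flag_mat_mult[OF assms] flag_mat_corner_eq_iff[OF assms])

text \<open>
  A matrix that kills \<open>v\<close> and is killed by \<open>f\<^sub>2\<close> from the left is upper triangular with respect to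
  \<open>v, v', e\<^sub>k\<close>, with first and last diagonal entry zero. The remaining diagonal entry is the trace.
\<close>

lemma matrix_is_flag_mat:
  fixes X :: "'k::field ^ 3 ^ 3"
  assumes d: "i \<noteq> j" "j \<noteq> k" "i \<noteq> k"
    and ker: "\<And>p. X $ p $ i + u * X $ p $ j + t * X $ p $ k = 0"
    and coker: "\<And>q. X $ k $ q = m * X $ j $ q + (t - u * m) * X $ i $ q"
    and tr: "trace X = 0"
  shows "\<exists>a b c. X = flag_mat i j k u t m a b c"
proof -
  define c where "c = X $ i $ k"
  define a where "a = X $ i $ j + m * c"
  define b where "b = X $ j $ k - u * c"
  have tr': "X $ i $ i + X $ j $ j + X $ k $ k = 0"
    using tr by (simp add: trace_def sum_distinct_3(1)[OF d])
  have ik: "X $ i $ k = c" and jk: "X $ j $ k = c * u + b" and ij: "X $ i $ j = a - m * c"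
    by (simp_all add: a_def b_def c_def)
  have ii: "X $ i $ i = - u * (a - m * c) - t * c"
    using ker[of i] unfolding ik ij by (simp add: algebra_simps eq_neg_iff_add_eq_0)
  have kk: "X $ k $ k = c * t + b * m" using coker[of k] unfolding ik jk by (simp add: algebra_simps)
  have jj: "X $ j $ j = u * a - m * (c * u + b)"
    using tr' unfolding ii kk by (simp add: algebra_simps eq_neg_iff_add_eq_0)
  have kj: "X $ k $ j = m * (u * a - m * (c * u + b)) + (t - u * m) * (a - m * c)"
    using coker[of j] unfolding ij jj .
  have ji: "X $ j $ i = - u * (u * a - m * (c * u + b)) - t * (c * u + b)"
    using ker[of j] unfolding jj jk by (simp add: algebra_simps eq_neg_iff_add_eq_0)
  have ki: "X $ k $ i = m * (- u * (u * a - m * (c * u + b)) - t * (c * u + b)) +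
      (t - u * m) * (- u * (a - m * c) - t * c)"
    using coker[of i] unfolding ii ji .
  have "X $ p $ q = flag_mat i j k u t m a b c $ p $ q" for p q
    using sum_distinct_3(2)[OF d, of p] sum_distinct_3(2)[OF d, of q] d
    by (auto simp: flag_mat_def ii ij ik ji jj jk ki kj kk algebra_simps)
  then have "X = flag_mat i j k u t m a b c" by (simp add: vec_eq_iff)
  then show ?thesis by blast
qed

lemma matrix_pow_mult_vec: "((\<lambda>v. X *v v) ^^ q) v = matrix_pow X q *v v"
  by (induction q) (simp_all add: matrix_vector_mul_assoc)

lemma matrix_pow_commute: "matrix_pow X q ** X = X ** matrix_pow X q"
  by (induction q) (simp_all flip: matrix_mul_assoc)

lemma vec_mult_matrix_pow: "((\<lambda>w. w v* X) ^^ q) w = w v* matrix_pow X q"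
  by (induction q) (simp_all add: matrix_pow_commute[symmetric] vector_matrix_mul_assoc)

text \<open>
  The transposes have a common kernel vector \<open>w\<close>. All \<open>x n\<close> map into the plane \<open>w = 0\<close>, so this
  plane is invariant and contains a common kernel vector \<open>v\<close>. Scaling \<open>v\<close> and \<open>w\<close> so that one
  coordinate of each is \<open>1\<close> puts the flag into one of finitely many charts with parameters \<open>u, t, m\<close>.
\<close>

lemma commuting_tuple_flag:
  fixes x :: "nat \<Rightarrow> 'k::field ^ 3 ^ 3"
  assumes nil: "\<And>n. n < r \<Longrightarrow> \<exists>q. matrix_pow (x n) q = 0"
    and tr: "\<And>n. n < r \<Longrightarrow> trace (x n) = 0"
    and comm: "\<And>n n'. n < r \<Longrightarrow> n' < r \<Longrightarrow> x n ** x n' = x n' ** x n"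
  shows "\<exists>i j k u t m. i \<noteq> j \<and> j \<noteq> k \<and> i \<noteq> k \<and> (\<forall>n<r. \<exists>a b c. x n = flag_mat i j k u t m a b c)"
proof -
  have "\<exists>w\<in>UNIV. w \<noteq> 0 \<and> (\<forall>n<r. w v* x n = 0)"
  proof (rule common_kernel[of 1])
    show "(1 :: 'k ^ 3) \<noteq> 0" by (simp add: vec_eq_iff)
    show "(w v* x n) v* x n' = (w v* x n') v* x n" if "n < r" "n' < r" for n n' w
      using comm[OF that] by (simp add: vector_matrix_mul_assoc)
    show "\<exists>q. ((\<lambda>w. w v* x n) ^^ q) w = 0" if n: "n < r" for n w
    proof -
      obtain q where "matrix_pow (x n) q = 0" using nil[OF n] by blast
      then have "((\<lambda>w. w v* x n) ^^ q) w = 0"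
        unfolding vec_mult_matrix_pow by (simp add: vec_eq_iff vector_matrix_mult_def)
      then show ?thesis by blast
    qed
  qed auto
  then obtain w where w: "w \<noteq> 0" "\<And>n. n < r \<Longrightarrow> w v* x n = 0" by blast
  let ?dot = "\<lambda>v. \<Sum>q\<in>UNIV. w $ q * v $ q"
  have dot0: "?dot (x n *v v) = 0" if "n < r" for n v
  proof -
    have "?dot (x n *v v) = (\<Sum>q\<in>UNIV. (w v* x n) $ q * v $ q)"
      unfolding matrix_vector_mult_def vector_matrix_mult_def
      by (simp add: sum_distrib_left sum_distrib_right mult_ac) (rule sum.swap)
    then show ?thesis using w(2)[OF that] by simp
  qed
  obtain s where s: "?dot s = 0" "s \<noteq> 0"
  proof (cases "w $ 1 = 0 \<and> w $ 2 = 0")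
    case True
    have "?dot (axis 1 1) = 0" using True by (simp add: sum_3 axis_def)
    then show ?thesis by (intro that[of "axis 1 1"]) auto
  next
    case False
    define s :: "'k ^ 3" where "s = (\<chi> q. if q = 1 then w $ 2 else if q = 2 then - w $ 1 else 0)"
    have "s $ 1 = w $ 2" "s $ 2 = - w $ 1" "?dot s = 0" by (simp_all add: s_def sum_3)
    then show ?thesis using False by (intro that[of s]) auto
  qed
  have "\<exists>v\<in>{v. ?dot v = 0}. v \<noteq> 0 \<and> (\<forall>n<r. x n *v v = 0)"
  proof (rule common_kernel[of s])
    show "x n *v (x n' *v v) = x n' *v (x n *v v)" if "n < r" "n' < r" for n n' v
      using comm[OF that] by (simp add: matrix_vector_mul_assoc)
    show "\<exists>q. ((\<lambda>v. x n *v v) ^^ q) v = 0" if n: "n < r" for n v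
    proof -
      obtain q where "matrix_pow (x n) q = 0" using nil[OF n] by blast
      then have "((\<lambda>v. x n *v v) ^^ q) v = 0"
        unfolding matrix_pow_mult_vec by (simp add: vec_eq_iff matrix_vector_mult_def)
      then show ?thesis by blast
    qed
  qed (use s dot0 in auto)
  then obtain v where v: "?dot v = 0" "v \<noteq> 0" "\<And>n. n < r \<Longrightarrow> x n *v v = 0" by blast
  obtain i where i: "v $ i \<noteq> 0" using v(2) by (auto simp: vec_eq_iff)
  \<comment> \<open>A form that vanishes at \<open>v\<close> is not a multiple of the \<open>i\<close>-th coordinate.\<close>
  have "\<exists>k. k \<noteq> i \<and> w $ k \<noteq> 0"
  proof (rule ccontr)
    assume "\<not> ?thesis"
    then have 0: "w $ k = 0" if "k \<noteq> i" for k using that by blast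
    then have "?dot v = (\<Sum>q\<in>UNIV. if q = i then w $ i * v $ i else 0)"
      by (intro sum.cong) auto
    then have "w $ i = 0" using v(1) i by simp
    then have "w $ k = 0" for k using 0 by (cases "k = i") auto
    then show False using w(1) by (simp add: vec_eq_iff)
  qed
  then obtain k where k: "k \<noteq> i" "w $ k \<noteq> 0" by blast
  have "card {i, k} < CARD(3)" using k(1) by (simp add: card_insert_if)
  then have "{i, k} \<noteq> UNIV" by (metis less_irrefl)
  then obtain j where j: "j \<noteq> i" "j \<noteq> k" by blast
  have d: "i \<noteq> j" "j \<noteq> k" "i \<noteq> k" using j k by auto
  define u t m where "u = v $ j / v $ i" and "t = v $ k / v $ i" and "m = - w $ j / w $ k"
  have vj: "v $ j = u * v $ i" and vk: "v $ k = t * v $ i" and wj: "w $ j = - m * w $ k"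
    using i k by (simp_all add: u_def t_def m_def)
  have "w $ i * v $ i + w $ j * v $ j + w $ k * v $ k = 0"
    using v(1) by (simp add: sum_distinct_3(1)[OF d])
  then have "(w $ i + (t - u * m) * w $ k) * v $ i = 0"
    unfolding vj vk wj by (simp add: algebra_simps)
  then have "w $ i + (t - u * m) * w $ k = 0" using i by simp
  then have wi: "w $ i = - ((t - u * m) * w $ k)" by (simp only: eq_neg_iff_add_eq_0)
  have "\<exists>a b c. x n = flag_mat i j k u t m a b c" if n: "n < r" for n
  proof (rule matrix_is_flag_mat[OF d _ _ tr[OF n]])
    show "x n $ p $ i + u * x n $ p $ j + t * x n $ p $ k = 0" for p
    proof -
      have "(x n *v v) $ p = 0" using v(3)[OF n] by simp
      then have "(x n $ p $ i + u * x n $ p $ j + t * x n $ p $ k) * v $ i = 0"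
        by (simp add: matrix_vector_mult_def sum_distinct_3(1)[OF d] vj vk algebra_simps)
      then show ?thesis using i by simp
    qed
    show "x n $ k $ q = m * x n $ j $ q + (t - u * m) * x n $ i $ q" for q
    proof -
      have "(w v* x n) $ q = 0" using w(2)[OF n] by simp
      then have "(x n $ k $ q - (m * x n $ j $ q + (t - u * m) * x n $ i $ q)) * w $ k = 0"
        by (simp add: vector_matrix_mult_def sum_distinct_3(1)[OF d] wi wj algebra_simps)
      then show ?thesis using k by simp
    qed
  qed
  then show ?thesis using d by blast
qed

section \<open>Commuting tuples in flag coordinates\<close>

definition flag_tuple ::
  "nat \<Rightarrow> 3 \<Rightarrow> 3 \<Rightarrow> 3 \<Rightarrow> 'k \<Rightarrow> 'k \<Rightarrow> 'k \<Rightarrow> (nat \<Rightarrow> 'k) \<Rightarrow> (nat \<Rightarrow> 'k) \<Rightarrow> (nat \<Rightarrow> 'k) \<Rightarrow> nat \<Rightarrow> 'k::field ^ 3 ^ 3"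
  where "flag_tuple r i j k u t m a b c = (\<lambda>n\<in>{..<r}. flag_mat i j k u t m (a n) (b n) (c n))"

lemma flag_tuple_apply:
  "n < r \<Longrightarrow> flag_tuple r i j k u t m a b c n = flag_mat i j k u t m (a n) (b n) (c n)"
  by (simp add: flag_tuple_def)

lemma flag_tuple_cong:
  "(\<And>n. n < r \<Longrightarrow> a n = a' n \<and> b n = b' n \<and> c n = c' n) \<Longrightarrow>
   flag_tuple r i j k u t m a b c = flag_tuple r i j k u t m a' b' c'"
  unfolding flag_tuple_def by (intro restrict_ext) simp

abbreviation "tuple_coords r \<equiv> {(\<lambda>x. x n $ p $ q) | n p q. n < (r::nat)}"

lemma flag_tuple_poly_funs:
  assumes "x \<in> tuple_coords r"
    and utm: "u \<in> poly_funs Y" "t \<in> poly_funs Y" "m \<in> poly_funs Y"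
    and abc: "\<And>n. n < r \<Longrightarrow> a n \<in> poly_funs Y" "\<And>n. n < r \<Longrightarrow> b n \<in> poly_funs Y"
      "\<And>n. n < r \<Longrightarrow> c n \<in> poly_funs Y"
  shows "(\<lambda>y. x (flag_tuple r i j k (u y) (t y) (m y) (\<lambda>n. a n y) (\<lambda>n. b n y) (\<lambda>n. c n y)))
    \<in> poly_funs Y"
proof -
  obtain n p q where x: "x = (\<lambda>x. x n $ p $ q)" and n: "n < r" using assms(1) by auto
  have if_poly: "(\<lambda>y. if P then f y else g y) \<in> poly_funs Y"
    if "f \<in> poly_funs Y" "g \<in> poly_funs Y" for P f g
    using that by (cases P) auto
  have f2: "(\<lambda>y. if q = i then u y * m y - t y else if q = j then - m y else 1) \<in> poly_funs Y"
    by (intro if_poly poly_funs_diff poly_funs_uminus poly_funs.mult poly_funs.const utm)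
  have f1: "(\<lambda>y. if q = i then - u y else if q = j then 1 else 0) \<in> poly_funs Y"
    by (intro if_poly poly_funs_uminus poly_funs.const utm)
  have v: "(\<lambda>y. if p = i then 1 else if p = j then u y else t y) \<in> poly_funs Y"
    by (intro if_poly poly_funs.const utm)
  have v': "(\<lambda>y. if p = i then 0 else if p = j then 1 else m y) \<in> poly_funs Y"
    by (intro if_poly poly_funs.const utm)
  show ?thesis
    unfolding x flag_tuple_apply[OF n] flag_mat_def vec_lambda_beta
    by (intro poly_funs.add poly_funs.mult v v' f1 f2 abc n)
qed

text \<open>
  The square is \<open>a b v f\<^sub>2\<close> and the cube vanishes, so only \<open>p = 2\<close> imposes a condition.
\<close>

lemma flag_mat_in_nil1:
  fixes a :: "'k::field"
  assumes "CHAR('k) > 0" and d: "i \<noteq> j" "j \<noteq> k" "i \<noteq> k"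
  shows "flag_mat i j k u t m a b c \<in> nil1 \<longleftrightarrow> CHAR('k) \<noteq> 2 \<or> a * b = 0"
proof -
  let ?x = "flag_mat i j k u t m a b c"
  have "CHAR('k) \<noteq> 1" using CHAR_not_1[where 'a = 'k] by simp
  then consider "CHAR('k) = 2" | e where "CHAR('k) = Suc (Suc (Suc e))"
    using assms(1) by (metis One_nat_def Suc_1 gr0_conv_Suc not0_implies_Suc)
  then have "matrix_pow ?x CHAR('k) = 0 \<longleftrightarrow> CHAR('k) \<noteq> 2 \<or> a * b = 0"
  proof cases
    case 1
    have "?x ** ?x = 0 \<longleftrightarrow> a * b = 0"
      using flag_mat_corner_eq_iff[OF d, of u t m "a * b" 0] flag_mat_zero[of i j k u t m]
      by (simp add: flag_mat_mult[OF d])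
    then show ?thesis using 1 by (simp add: numeral_2_eq_2)
  next
    case (2 e)
    have "matrix_pow ?x CHAR('k) = ((?x ** ?x) ** ?x) ** matrix_pow ?x e"
      unfolding 2 by (simp add: matrix_mul_assoc)
    then show ?thesis using 2 by (simp add: flag_mat_mult[OF d] flag_mat_zero)
  qed
  then show ?thesis by (simp add: nil1_def sl3_def flag_mat_trace[OF d])
qed

lemma flag_tuple_in_comm_tuples_nil1:
  fixes a :: "nat \<Rightarrow> 'k::field"
  assumes ch: "CHAR('k) > 0" and d: "i \<noteq> j" "j \<noteq> k" "i \<noteq> k"
  shows "flag_tuple r i j k u t m a b c \<in> comm_tuples r nil1 \<longleftrightarrow>
    (\<forall>n<r. CHAR('k) \<noteq> 2 \<or> a n * b n = 0) \<and> (\<forall>n<r. \<forall>n'<r. a n * b n' = a n' * b n)"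
proof -
  let ?x = "flag_tuple r i j k u t m a b c"
  have "?x \<in> {..<r} \<rightarrow>\<^sub>E nil1 \<longleftrightarrow> (\<forall>n<r. CHAR('k) \<noteq> 2 \<or> a n * b n = 0)"
    by (auto simp: PiE_iff flag_tuple_apply flag_mat_in_nil1[OF ch d] flag_tuple_def)
  moreover have "(\<forall>n'<r. \<forall>n\<le>n'. lie (?x n) (?x n') = 0) \<longleftrightarrow>
      (\<forall>n'<r. \<forall>n\<le>n'. a n * b n' = a n' * b n)"
    by (simp add: flag_tuple_apply lie_flag_mat[OF d])
  moreover have "\<dots> \<longleftrightarrow> (\<forall>n<r. \<forall>n'<r. a n * b n' = a n' * b n)"
    by (metis le_less_trans nat_le_linear)
  ultimately show ?thesis unfolding comm_tuples_def by simp
qed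

lemma flag_tuple_exists:
  assumes x: "x \<in> {..<r} \<rightarrow>\<^sub>E V" and ex: "\<forall>n<r. \<exists>a b c. x n = flag_mat i j k u t m a b c"
  shows "\<exists>a b c. x = flag_tuple r i j k u t m a b c"
proof -
  have "\<forall>n\<in>{..<r}. \<exists>abc. x n = flag_mat i j k u t m (fst abc) (fst (snd abc)) (snd (snd abc))"
    using ex by simp
  from bchoice[OF this] obtain f where
    f: "\<forall>n\<in>{..<r}. x n = flag_mat i j k u t m (fst (f n)) (fst (snd (f n))) (snd (snd (f n)))" ..
  have "x = flag_tuple r i j k u t m (\<lambda>n. fst (f n)) (\<lambda>n. fst (snd (f n))) (\<lambda>n. snd (snd (f n)))"
  proof
    fix n
    show "x n = flag_tuple r i j k u t m (\<lambda>n. fst (f n)) (\<lambda>n. fst (snd (f n))) (\<lambda>n. snd (snd (f n))) n"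
      using f PiE_arb[OF x, of n] by (cases "n < r") (simp_all add: flag_tuple_def)
  qed
  then show ?thesis by (intro exI)
qed

lemma comm_tuples_nil1_cases:
  fixes x :: "nat \<Rightarrow> 'k::field ^ 3 ^ 3"
  assumes "x \<in> comm_tuples r nil1"
  obtains i j k u t m a b c
  where "i \<noteq> j" "j \<noteq> k" "i \<noteq> k" "x = flag_tuple r i j k u t m a b c"
proof -
  have x: "x \<in> {..<r} \<rightarrow>\<^sub>E nil1" and c: "\<And>n n'. n' < r \<Longrightarrow> n \<le> n' \<Longrightarrow> lie (x n) (x n') = 0"
    using assms unfolding comm_tuples_def by auto
  have nil: "trace (x n) = 0" "matrix_pow (x n) CHAR('k) = 0" if "n < r" for n
    using PiE_mem[OF x, of n] that by (simp_all add: nil1_def sl3_def)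
  have comm: "x n ** x n' = x n' ** x n" if "n < r" "n' < r" for n n'
    using c[of n n'] c[of n' n] that unfolding lie_def by (cases "n \<le> n'") auto
  have "\<exists>q. matrix_pow (x n) q = 0" if "n < r" for n using nil(2)[OF that] by blast
  then have "\<exists>i j k u t m. i \<noteq> j \<and> j \<noteq> k \<and> i \<noteq> k \<and>
      (\<forall>n<r. \<exists>a b c. x n = flag_mat i j k u t m a b c)"
    using nil(1) comm by (rule commuting_tuple_flag)
  then obtain i j k u t m where d: "i \<noteq> j" "j \<noteq> k" "i \<noteq> k"
    and ex: "\<forall>n<r. \<exists>a b c. x n = flag_mat i j k u t m a b c"
    by (elim exE conjE)
  from flag_tuple_exists[OF x ex] obtain a b c where "x = flag_tuple r i j k u t m a b c"
    by (elim exE)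
  with d show ?thesis by (rule that)
qed

text \<open>The index \<open>3\<close> is the first row or column, because \<open>3 = 0\<close> in the index type.\<close>

lemma strict_upper_iff_flag_mat:
  "x \<in> strict_upper \<longleftrightarrow> (\<exists>a b c. x = flag_mat 3 1 2 0 0 0 a b c)"
proof -
  have ord: "(1::3) \<le> 1" "(2::3) \<le> 2" "(3::3) \<le> 3" "(3::3) \<le> 1" "(3::3) \<le> 2" "(1::3) \<le> 2"
    "\<not> (1::3) \<le> 3" "\<not> (2::3) \<le> 3" "\<not> (2::3) \<le> 1"
    by (simp_all add: less_eq_bit1_def bit1.Rep_numeral bit1.Rep_1)
  show ?thesis
  proof
    assume "x \<in> strict_upper"
    then have "x $ i $ j = 0" if "j \<le> i" for i j using that unfolding strict_upper_def by blast
    then have "x = flag_mat 3 1 2 0 0 0 (x $ 3 $ 1) (x $ 1 $ 2) (x $ 3 $ 2)"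
      using ord by (simp add: vec_eq_iff forall_3 flag_mat_def)
    then show "\<exists>a b c. x = flag_mat 3 1 2 0 0 0 a b c" by blast
  next
    assume "\<exists>a b c. x = flag_mat 3 1 2 0 0 0 a b c"
    then obtain a b c where x: "x = flag_mat 3 1 2 0 0 0 a b c" by blast
    have "trace x = 0" unfolding x by (rule flag_mat_trace) auto
    moreover have "\<forall>i j. j \<le> i \<longrightarrow> x $ i $ j = 0"
      unfolding x using ord by (simp add: forall_3 flag_mat_def)
    ultimately show "x \<in> strict_upper" unfolding strict_upper_def sl3_def by simp
  qed
qed

lemma comm_tuples_u1_iff:
  "x \<in> comm_tuples r u1 \<longleftrightarrow> x \<in> comm_tuples r nil1 \<and> (\<forall>n<r. x n \<in> strict_upper)"
  by (auto simp: comm_tuples_def u1_def PiE_iff)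

lemma comm_tuples_u1_cases:
  fixes x :: "nat \<Rightarrow> 'k::field ^ 3 ^ 3"
  assumes "x \<in> comm_tuples r u1"
  obtains a b c where "x = flag_tuple r 3 1 2 0 0 0 a b c"
proof -
  have "\<forall>n<r. \<exists>a b c. x n = flag_mat 3 1 2 0 0 0 a b c"
    using assms unfolding comm_tuples_u1_iff strict_upper_iff_flag_mat by blast
  moreover have "x \<in> {..<r} \<rightarrow>\<^sub>E u1" using assms by (simp add: comm_tuples_def)
  ultimately have "\<exists>a b c. x = flag_tuple r 3 1 2 0 0 0 a b c" by (intro flag_tuple_exists)
  then show ?thesis using that by (elim exE)
qed

lemma comm_tuples_subset: "comm_tuples r V \<subseteq> {..<r} \<rightarrow>\<^sub>E UNIV"
  by (auto simp: comm_tuples_def)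

text \<open>
  The commutation conditions say that the two-row matrix with rows \<open>a\<close> and \<open>b\<close> has rank at most one.
\<close>

lemma rank_one_cases:
  fixes a b :: "nat \<Rightarrow> 'k::field"
  assumes "\<forall>n<r. \<forall>n'<r. a n * b n' = a n' * b n"
  shows "(\<forall>n<r. a n = 0) \<or> (\<exists>\<tau>. \<forall>n<r. b n = \<tau> * a n)"
proof (cases "\<forall>n<r. a n = 0")
  case False
  then obtain n0 where n0: "n0 < r" "a n0 \<noteq> 0" by blast
  have "b n = (b n0 / a n0) * a n" if "n < r" for n
    using assms[rule_format, OF n0(1) that] n0(2) by (simp add: field_simps)
  then show ?thesis by blast
qed blast

section \<open>Tuples over a pencil\<close>

text \<open>
  The parameters are ordered in such a way that, for the standard flag, setting all but the first
  few of them to zero gives the members of a chain of maximal length. The coefficients \<open>s n\<close> sit at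
  \<open>r, r + 2, r + 3, \<dots>, 2 r\<close>; the gap at \<open>r + 1\<close> is for the slope \<open>\<tau>\<close>.
\<close>

definition s_index :: "nat \<Rightarrow> nat \<Rightarrow> nat" where
  "s_index r n = (if n = 0 then r else r + 1 + n)"

text \<open>
  The pairs \<open>(a n, b n)\<close> are multiples of one point \<open>(\<sigma>, \<tau>)\<close> of the projective line, which
  consists of the affine chart \<open>(1, \<tau>)\<close> and the point \<open>(0, 1)\<close>.
\<close>

definition pencil_tuple ::
  "nat \<Rightarrow> 3 \<Rightarrow> 3 \<Rightarrow> 3 \<Rightarrow> 'k \<Rightarrow> 'k \<Rightarrow> 'k \<Rightarrow> 'k \<Rightarrow> 'k \<Rightarrow> (nat \<Rightarrow> 'k) \<Rightarrow> nat \<Rightarrow> 'k::field ^ 3 ^ 3" where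
  "pencil_tuple r i j k u t m \<sigma> \<tau> y = flag_tuple r i j k u t m
     (\<lambda>n. \<sigma> * y (s_index r n)) (\<lambda>n. \<tau> * y (s_index r n)) (\<lambda>n. y n)"

lemma pencil_parameters_exist:
  fixes s c :: "nat \<Rightarrow> 'k::field"
  assumes "r \<ge> 1"
  shows "\<exists>y :: nat \<Rightarrow> 'k. (\<forall>n<r. y n = c n) \<and> (\<forall>n<r. y (s_index r n) = s n) \<and>
    y (r + 1) = \<tau> \<and> y (2 * r + 1) = u \<and> y (2 * r + 2) = m \<and> y (2 * r + 3) = t"
proof (intro exI conjI allI impI)
  let ?y = "\<lambda>l. if l < r then c l else if l = r then s 0 else if l = r + 1 then \<tau> else
    if l < 2 * r + 1 then s (l - r - 1) else if l = 2 * r + 1 then u else if l = 2 * r + 2 then m else t"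
  show "?y n = c n" if "n < r" for n using that by simp
  show "?y (s_index r n) = s n" if "n < r" for n using that by (simp add: s_index_def)
qed (use assms in simp_all)

lemma flag_tuple_eq_pencil_tuple:
  fixes a b c :: "nat \<Rightarrow> 'k::field"
  assumes r: "r \<ge> 1" and rank: "\<forall>n<r. \<forall>n'<r. a n * b n' = a n' * b n"
  shows "\<exists>y. y (2 * r + 1) = u \<and> y (2 * r + 2) = m \<and> y (2 * r + 3) = t \<and>
    (flag_tuple r i j k u t m a b c = pencil_tuple r i j k u t m 1 (y (r + 1)) y \<or>
     flag_tuple r i j k u t m a b c = pencil_tuple r i j k u t m 0 1 y)"
proof -
  have "(\<forall>n<r. a n = 0) \<or> (\<exists>\<tau>. \<forall>n<r. b n = \<tau> * a n)"
    by (rule rank_one_cases[OF rank])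
  then show ?thesis
  proof (elim disjE exE)
    assume 1: "\<forall>n<r. a n = 0"
    from pencil_parameters_exist[OF r, of c b "0" u m t]
    obtain y where y: "\<forall>n<r. y n = c n" "\<forall>n<r. y (s_index r n) = b n"
      "y (r + 1) = 0" "y (2 * r + 1) = u" "y (2 * r + 2) = m" "y (2 * r + 3) = t"
      by (elim exE conjE)
    have "flag_tuple r i j k u t m a b c = pencil_tuple r i j k u t m 0 1 y"
      unfolding pencil_tuple_def by (intro flag_tuple_cong) (simp add: y 1)
    then show ?thesis using y(3-6) by blast
  next
    fix \<tau> assume 2: "\<forall>n<r. b n = \<tau> * a n"
    from pencil_parameters_exist[OF r, of c a "\<tau>" u m t]
    obtain y where y: "\<forall>n<r. y n = c n" "\<forall>n<r. y (s_index r n) = a n"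
      "y (r + 1) = \<tau>" "y (2 * r + 1) = u" "y (2 * r + 2) = m" "y (2 * r + 3) = t"
      by (elim exE conjE)
    have "flag_tuple r i j k u t m a b c = pencil_tuple r i j k u t m 1 (y (r + 1)) y"
      unfolding pencil_tuple_def by (intro flag_tuple_cong) (use y 2 in simp)
    then show ?thesis using y(3-6) by blast
  qed
qed

lemma pencil_tuple_poly_funs:
  assumes "x \<in> tuple_coords r" "r \<ge> 1" "2 * r + 1 \<le> N"
    and "u \<in> poly_funs (coords N)" "t \<in> poly_funs (coords N)" "m \<in> poly_funs (coords N)"
      "\<sigma> \<in> poly_funs (coords N)" "\<tau> \<in> poly_funs (coords N)"
  shows "(\<lambda>y. x (pencil_tuple r i j k (u y) (t y) (m y) (\<sigma> y) (\<tau> y) y)) \<in> poly_funs (coords N)"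
  unfolding pencil_tuple_def using assms
  by (intro flag_tuple_poly_funs poly_funs.mult coords_in_poly_funs) (auto simp: s_index_def)

lemma dim_comm_nil1_le:
  assumes r: "r \<ge> 1" and ch: "CHAR('k::field) > 0"
  shows "variety_dim r (comm_tuples r (nil1 :: ('k ^ 3 ^ 3) set)) \<le> enat (2 * r + 4)"
  unfolding variety_dim_def tuple_space_def
proof (rule krull_dim_le[OF comm_tuples_subset])
  let ?f = "\<lambda>(i, j, k) y :: nat \<Rightarrow> 'k. pencil_tuple r i j k (y (2 * r + 1)) (y (2 * r + 3)) (y (2 * r + 2)) 1 (y (r + 1)) y"
  let ?g = "\<lambda>(i, j, k) y :: nat \<Rightarrow> 'k. pencil_tuple r i j k (y (2 * r + 1)) (y (2 * r + 3)) (y (2 * r + 2)) 0 1 y"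
  show "finite (range ?f \<union> range ?g)" by simp
  show "comm_tuples r nil1 \<subseteq> (\<Union>\<phi>\<in>range ?f \<union> range ?g. range \<phi>)"
  proof
    fix x :: "nat \<Rightarrow> 'k ^ 3 ^ 3" assume x: "x \<in> comm_tuples r nil1"
    obtain i j k u t m a b c where d: "i \<noteq> j" "j \<noteq> k" "i \<noteq> k" and eq: "x = flag_tuple r i j k u t m a b c"
      using comm_tuples_nil1_cases[OF x] by blast
    have "\<forall>n<r. \<forall>n'<r. a n * b n' = a n' * b n"
      using x unfolding eq flag_tuple_in_comm_tuples_nil1[OF ch d] ..
    from flag_tuple_eq_pencil_tuple[OF r this, of u m t i j k c]
    obtain y where "y (2 * r + 1) = u" "y (2 * r + 2) = m" "y (2 * r + 3) = t"
      "x = pencil_tuple r i j k u t m 1 (y (r + 1)) y \<or> x = pencil_tuple r i j k u t m 0 1 y"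
      unfolding eq by (elim exE conjE)
    then have "x = ?f (i, j, k) y \<or> x = ?g (i, j, k) y" by simp
    then show "x \<in> (\<Union>\<phi>\<in>range ?f \<union> range ?g. range \<phi>)" by blast
  qed
  show "(\<lambda>y. x (\<phi> y)) \<in> poly_funs (coords (2 * r + 4))"
    if "\<phi> \<in> range ?f \<union> range ?g" "x \<in> tuple_coords r" for \<phi> x
    using that r
    by (auto intro!: pencil_tuple_poly_funs coords_in_poly_funs poly_funs.const)
qed

lemma dim_comm_u1_le:
  assumes r: "r \<ge> 1" and ch: "CHAR('k::field) > 0"
  shows "variety_dim r (comm_tuples r (u1 :: ('k ^ 3 ^ 3) set)) \<le> enat (2 * r + 1)"
  unfolding variety_dim_def tuple_space_def
proof (rule krull_dim_le[OF comm_tuples_subset])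
  let ?f = "\<lambda>y :: nat \<Rightarrow> 'k. pencil_tuple r 3 1 2 0 0 0 1 (y (r + 1)) y"
  let ?g = "\<lambda>y :: nat \<Rightarrow> 'k. pencil_tuple r 3 1 2 0 0 0 0 1 y"
  show "finite {?f, ?g}" by simp
  show "comm_tuples r u1 \<subseteq> (\<Union>\<phi>\<in>{?f, ?g}. range \<phi>)"
  proof
    fix x :: "nat \<Rightarrow> 'k ^ 3 ^ 3" assume x: "x \<in> comm_tuples r u1"
    obtain a b c where eq: "x = flag_tuple r 3 1 2 0 0 0 a b c" using comm_tuples_u1_cases[OF x] by blast
    have "x \<in> comm_tuples r nil1" using x by (simp add: comm_tuples_u1_iff)
    then have "\<forall>n<r. \<forall>n'<r. a n * b n' = a n' * b n"
      using flag_tuple_in_comm_tuples_nil1[OF ch, of 3 1 2 r] unfolding eq by simp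
    from flag_tuple_eq_pencil_tuple[OF r this, of 0 0 0 3 1 2 c]
    obtain y where "x = pencil_tuple r 3 1 2 0 0 0 1 (y (r + 1)) y \<or> x = pencil_tuple r 3 1 2 0 0 0 0 1 y"
      unfolding eq by (elim exE conjE)
    then show "x \<in> (\<Union>\<phi>\<in>{?f, ?g}. range \<phi>)" by blast
  qed
  show "(\<lambda>y. x (\<phi> y)) \<in> poly_funs (coords (2 * r + 1))"
    if "\<phi> \<in> {?f, ?g}" "x \<in> tuple_coords r" for \<phi> x
    using that r
    by (auto intro!: pencil_tuple_poly_funs coords_in_poly_funs poly_funs.const)
qed

text \<open>
  The first \<open>2 r + 1\<close> parameters describe strictly upper triangular tuples, and each of them is, up
  to a factor, an entry. Next, \<open>u\<close> moves the line spanned by \<open>v\<close> inside the plane of the first two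
  coordinates, which makes a diagonal entry nonzero. Then \<open>m\<close> tilts the plane spanned by
  \<open>v\<close> and \<open>v'\<close>, which contains all images, and the last row of \<open>x 0\<close> becomes nonzero. The line
  spanned by \<open>v\<close>, which contains the image of \<open>x 0 ** x 0\<close>, still lies in the plane of the first two
  coordinates and leaves it only with \<open>t\<close>, so that the last row of \<open>x 0 ** x 0\<close> detects \<open>t\<close>.
\<close>

lemma pencil_tuple_witness:
  fixes r :: nat
  defines "\<phi> \<equiv> (\<lambda>y :: nat \<Rightarrow> 'k::field. pencil_tuple r 3 1 2 (y (2 * r + 1)) (y (2 * r + 3)) (y (2 * r + 2)) 1 (y (r + 1)) y)"
  assumes r: "r \<ge> 1" and i: "i < 2 * r + 4"
  shows "\<exists>f\<in>poly_funs (tuple_coords r).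
    (\<forall>y\<in>affine_sub i. f (\<phi> y) = 0) \<and> (\<exists>y\<in>affine_sub (Suc i). f (\<phi> y) \<noteq> 0)"
proof -
  \<comment> \<open>On \<open>affine_sub (Suc i)\<close> every witness below is a monomial in the parameters up to \<open>i\<close>.\<close>
  define e :: "nat \<Rightarrow> 'k" where "e l = (if l \<le> i then 1 else 0)" for l
  have e: "e \<in> affine_sub (Suc i)" by (auto simp: affine_sub_def e_def)
  have entry: "(\<lambda>x. x n $ p $ q) \<in> poly_funs (tuple_coords r)" if "n < r" for n p q
    using that by (intro poly_funs.coord) auto
  have \<phi>: "\<phi> y n = flag_mat 3 1 2 (y (2 * r + 1)) (y (2 * r + 3)) (y (2 * r + 2))
      (y (s_index r n)) (y (r + 1) * y (s_index r n)) (y n)" if "n < r" for y n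
    using that by (simp add: \<phi>_def pencil_tuple_def flag_tuple_apply)
  note simps = \<phi> flag_mat_def affine_sub_def e_def s_index_def
  consider "i < r" | "i = r" | "i = r + 1" | n where "1 \<le> n" "n < r" "i = r + 1 + n"
    | "i = 2 * r + 1" | "i = 2 * r + 2" | "i = 2 * r + 3"
  proof -
    have "i < r \<or> i = r \<or> i = r + 1 \<or> (1 \<le> i - r - 1 \<and> i - r - 1 < r \<and> i = r + 1 + (i - r - 1))
      \<or> i = 2 * r + 1 \<or> i = 2 * r + 2 \<or> i = 2 * r + 3" using i by arith
    then show ?thesis using that by metis
  qed
  then show ?thesis
  proof cases
    case 1
    then show ?thesis using e by (intro bexI[OF _ entry[of i 3 2]] conjI bexI[of _ e]) (auto simp: simps)
  next
    case 2
    then show ?thesis using e r by (intro bexI[OF _ entry[of 0 3 1]] conjI bexI[of _ e]) (auto simp: simps)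
  next
    case 3
    then show ?thesis using e r by (intro bexI[OF _ entry[of 0 1 2]] conjI bexI[of _ e]) (auto simp: simps)
  next
    case (4 n)
    then show ?thesis using e r by (intro bexI[OF _ entry[of n 3 1]] conjI bexI[of _ e]) (auto simp: simps)
  next
    case 5
    then show ?thesis using e r by (intro bexI[OF _ entry[of 0 1 1]] conjI bexI[of _ e]) (auto simp: simps)
  next
    case 6
    then show ?thesis using e r by (intro bexI[OF _ entry[of 0 2 2]] conjI bexI[of _ e]) (auto simp: simps)
  next
    case 7
    let ?f = "\<lambda>x :: nat \<Rightarrow> 'k ^ 3 ^ 3. \<Sum>q\<in>UNIV. x 0 $ 2 $ q * x 0 $ q $ 2"
    have f: "?f \<in> poly_funs (tuple_coords r)"
      using r by (intro poly_funs_sum poly_funs.mult entry) auto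
    have "?f (\<phi> y) = y (2 * r + 3) * (y r * (y (r + 1) * y r))" for y
    proof -
      have "?f (\<phi> y) = (\<phi> y 0 ** \<phi> y 0) $ 2 $ 2" by (simp add: matrix_matrix_mult_def)
      also have "\<dots> = y (2 * r + 3) * (y r * (y (r + 1) * y r))"
        using r by (simp add: \<phi> flag_mat_mult) (simp add: flag_mat_def s_index_def)
      finally show ?thesis .
    qed
    then show ?thesis
      using 7 e by (intro bexI[OF _ f] conjI bexI[of _ e]) (auto simp: affine_sub_def e_def)
  qed
qed

lemma dim_comm_ge_char_neq_2:
  assumes r: "r \<ge> 1" and ch: "CHAR('k::alg_closed_field) > 0" "CHAR('k) \<noteq> 2"
  shows "variety_dim r (comm_tuples r (nil1 :: ('k ^ 3 ^ 3) set)) \<ge> enat (2 * r + 4)"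
    and "variety_dim r (comm_tuples r (u1 :: ('k ^ 3 ^ 3) set)) \<ge> enat (2 * r + 1)"
proof -
  let ?\<phi> = "\<lambda>y :: nat \<Rightarrow> 'k. pencil_tuple r 3 1 2 (y (2 * r + 1)) (y (2 * r + 3)) (y (2 * r + 2)) 1 (y (r + 1)) y"
  have poly: "(\<lambda>y. x (?\<phi> y)) \<in> poly_funs (coords (2 * r + 4))" if "x \<in> tuple_coords r" for x
    using that r by (intro pencil_tuple_poly_funs coords_in_poly_funs poly_funs.const) auto
  have nil: "?\<phi> y \<in> comm_tuples r nil1" for y
    unfolding pencil_tuple_def using ch by (subst flag_tuple_in_comm_tuples_nil1) auto
  have "?\<phi> y n \<in> strict_upper" if "y \<in> affine_sub (2 * r + 1)" "n < r" for y n
    using that by (auto simp: affine_sub_def pencil_tuple_def flag_tuple_apply strict_upper_iff_flag_mat)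
  then have u: "?\<phi> ` affine_sub (2 * r + 1) \<subseteq> comm_tuples r u1"
    using nil by (auto simp: comm_tuples_u1_iff)
  show "variety_dim r (comm_tuples r (nil1 :: ('k ^ 3 ^ 3) set)) \<ge> enat (2 * r + 4)"
    unfolding variety_dim_def tuple_space_def
    by (rule krull_dim_ge[where \<phi> = ?\<phi>, OF infinite_UNIV_alg_closed comm_tuples_subset poly])
      (assumption, use nil in blast, rule pencil_tuple_witness[OF r])
  show "variety_dim r (comm_tuples r (u1 :: ('k ^ 3 ^ 3) set)) \<ge> enat (2 * r + 1)"
    unfolding variety_dim_def tuple_space_def
    by (rule krull_dim_ge[where \<phi> = ?\<phi>, OF infinite_UNIV_alg_closed comm_tuples_subset poly u])
      (assumption, rule pencil_tuple_witness[OF r], simp)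
qed

section \<open>Square-zero matrices with a common image or a common kernel\<close>

text \<open>
  For \<open>p = 2\<close> also \<open>a n * b n = 0\<close>, which leaves two families: all images are contained in the line
  spanned by \<open>v\<close> (if \<open>b = 0\<close>), or all kernels contain the plane spanned by \<open>v\<close> and \<open>v'\<close> (if
  \<open>a = 0\<close>). The rest of the flag is then redundant and can be normalised, which saves one of the
  three flag parameters.
\<close>

definition line_tuple :: "nat \<Rightarrow> 3 \<Rightarrow> 3 \<Rightarrow> 3 \<Rightarrow> 'k \<Rightarrow> 'k \<Rightarrow> (nat \<Rightarrow> 'k) \<Rightarrow> nat \<Rightarrow> 'k::field ^ 3 ^ 3" where
  "line_tuple r i j k u t y = flag_tuple r i j k u t 0 (\<lambda>n. y (r + n)) (\<lambda>_. 0) (\<lambda>n. y n)"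

definition plane_tuple :: "nat \<Rightarrow> 3 \<Rightarrow> 3 \<Rightarrow> 3 \<Rightarrow> 'k \<Rightarrow> 'k \<Rightarrow> (nat \<Rightarrow> 'k) \<Rightarrow> nat \<Rightarrow> 'k::field ^ 3 ^ 3" where
  "plane_tuple r i j k m t y = flag_tuple r i j k 0 t m (\<lambda>_. 0) (\<lambda>n. y (r + n)) (\<lambda>n. y n)"

lemma line_tuple_poly_funs:
  assumes "x \<in> tuple_coords r" "2 * r \<le> N" "u \<in> poly_funs (coords N)" "t \<in> poly_funs (coords N)"
  shows "(\<lambda>y. x (line_tuple r i j k (u y) (t y) y)) \<in> poly_funs (coords N)"
  unfolding line_tuple_def using assms
  by (intro flag_tuple_poly_funs poly_funs.const coords_in_poly_funs) auto

lemma plane_tuple_poly_funs: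
  assumes "x \<in> tuple_coords r" "2 * r \<le> N" "m \<in> poly_funs (coords N)" "t \<in> poly_funs (coords N)"
  shows "(\<lambda>y. x (plane_tuple r i j k (m y) (t y) y)) \<in> poly_funs (coords N)"
  unfolding plane_tuple_def using assms
  by (intro flag_tuple_poly_funs poly_funs.const coords_in_poly_funs) auto

text \<open>
  The matrix is \<open>v\<close> times a linear form that vanishes at \<open>v\<close>; any choice of \<open>v'\<close> gives a basis of
  these forms.
\<close>

lemma flag_mat_line: "flag_mat i j k u t m a 0 c = flag_mat i j k u t 0 (a - m * c) 0 c"
  by (simp add: flag_mat_def vec_eq_iff algebra_simps)

text \<open>
  The matrix is a vector of the plane spanned by \<open>v\<close> and \<open>v'\<close> times the form \<open>f\<^sub>2\<close>; the vector \<open>v\<close>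
  can be replaced by \<open>v - u v'\<close>.
\<close>

lemma flag_mat_plane: "flag_mat i j k u t m 0 b c = flag_mat i j k 0 (t - u * m) m 0 (u * c + b) c"
  by (simp add: flag_mat_def vec_eq_iff algebra_simps)

lemma line_plane_parameters_exist:
  fixes s c :: "nat \<Rightarrow> 'k::field"
  shows "\<exists>y :: nat \<Rightarrow> 'k. (\<forall>n<r. y n = c n) \<and> (\<forall>n<r. y (r + n) = s n) \<and>
    y (2 * r) = u \<and> y (2 * r + 1) = t"
proof (intro exI conjI allI impI)
  let ?y = "\<lambda>l. if l < r then c l else if l < 2 * r then s (l - r) else if l = 2 * r then u else t"
  show "?y n = c n" if "n < r" for n using that by simp
qed simp_all

lemma flag_tuple_eq_line_or_plane_tuple:
  fixes a b c :: "nat \<Rightarrow> 'k::field"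
  assumes rank: "\<forall>n<r. \<forall>n'<r. a n * b n' = a n' * b n"
    and sq: "\<forall>n<r. a n * b n = 0"
  shows "\<exists>y. flag_tuple r i j k u t m a b c = line_tuple r i j k u t y
        \<and> y (2 * r) = u \<and> y (2 * r + 1) = t
      \<or> flag_tuple r i j k u t m a b c = plane_tuple r i j k m (t - u * m) y
        \<and> y (2 * r) = m \<and> y (2 * r + 1) = t - u * m"
proof -
  have "(\<forall>n<r. a n = 0) \<or> (\<exists>\<tau>. \<forall>n<r. b n = \<tau> * a n)"
    by (rule rank_one_cases[OF rank])
  then show ?thesis
  proof (elim disjE exE)
    assume 1: "\<forall>n<r. a n = 0"
    from line_plane_parameters_exist[of r c "\<lambda>n. u * c n + b n" m "t - u * m"]
    obtain y where y: "\<forall>n<r. y n = c n" "\<forall>n<r. y (r + n) = u * c n + b n"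
      "y (2 * r) = m" "y (2 * r + 1) = t - u * m"
      by (elim exE conjE)
    have "flag_tuple r i j k u t m a b c = plane_tuple r i j k m (t - u * m) y"
      unfolding plane_tuple_def flag_tuple_def
      by (intro restrict_ext) (simp add: y 1 flag_mat_plane[of i j k u])
    then show ?thesis using y(3,4) by blast
  next
    fix \<tau> assume 2: "\<forall>n<r. b n = \<tau> * a n"
    have b: "b n = 0" if "n < r" for n using 2 sq that by auto
    from line_plane_parameters_exist[of r c "\<lambda>n. a n - m * c n" u t]
    obtain y where y: "\<forall>n<r. y n = c n" "\<forall>n<r. y (r + n) = a n - m * c n"
      "y (2 * r) = u" "y (2 * r + 1) = t"
      by (elim exE conjE)
    have "flag_tuple r i j k u t m a b c = line_tuple r i j k u t y"
      unfolding line_tuple_def flag_tuple_def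
      by (intro restrict_ext) (simp add: y b flag_mat_line[of i j k u t m])
    then show ?thesis using y(3,4) by blast
  qed
qed

lemma dim_comm_nil1_le_char_2:
  assumes ch: "CHAR('k::field) = 2"
  shows "variety_dim r (comm_tuples r (nil1 :: ('k ^ 3 ^ 3) set)) \<le> enat (2 * r + 2)"
  unfolding variety_dim_def tuple_space_def
proof (rule krull_dim_le[OF comm_tuples_subset])
  let ?f = "\<lambda>(i, j, k) y :: nat \<Rightarrow> 'k. line_tuple r i j k (y (2 * r)) (y (2 * r + 1)) y"
  let ?g = "\<lambda>(i, j, k) y :: nat \<Rightarrow> 'k. plane_tuple r i j k (y (2 * r)) (y (2 * r + 1)) y"
  show "finite (range ?f \<union> range ?g)" by simp
  show "comm_tuples r nil1 \<subseteq> (\<Union>\<phi>\<in>range ?f \<union> range ?g. range \<phi>)"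
  proof
    fix x :: "nat \<Rightarrow> 'k ^ 3 ^ 3" assume x: "x \<in> comm_tuples r nil1"
    obtain i j k u t m a b c where d: "i \<noteq> j" "j \<noteq> k" "i \<noteq> k" and eq: "x = flag_tuple r i j k u t m a b c"
      using comm_tuples_nil1_cases[OF x] by blast
    have "CHAR('k) > 0" using ch by simp
    note mem = x[unfolded eq flag_tuple_in_comm_tuples_nil1[OF this d]]
    have rank: "\<forall>n<r. \<forall>n'<r. a n * b n' = a n' * b n" using mem ..
    have sq: "\<forall>n<r. a n * b n = 0" using mem ch by blast
    from flag_tuple_eq_line_or_plane_tuple[OF rank sq, where u = u and t = t and m = m and c = c and i = i and j = j and k = k]
    obtain y where "x = line_tuple r i j k u t y \<and> y (2 * r) = u \<and> y (2 * r + 1) = t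
        \<or> x = plane_tuple r i j k m (t - u * m) y \<and> y (2 * r) = m \<and> y (2 * r + 1) = t - u * m"
      unfolding eq by (elim exE)
    then have "x = ?f (i, j, k) y \<or> x = ?g (i, j, k) y" by auto
    then show "x \<in> (\<Union>\<phi>\<in>range ?f \<union> range ?g. range \<phi>)" by blast
  qed
  show "(\<lambda>y. x (\<phi> y)) \<in> poly_funs (coords (2 * r + 2))"
    if "\<phi> \<in> range ?f \<union> range ?g" "x \<in> tuple_coords r" for \<phi> x
    using that
    by (auto intro!: line_tuple_poly_funs plane_tuple_poly_funs coords_in_poly_funs)
qed

lemma dim_comm_u1_le_char_2:
  assumes ch: "CHAR('k::field) = 2"
  shows "variety_dim r (comm_tuples r (u1 :: ('k ^ 3 ^ 3) set)) \<le> enat (2 * r)"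
  unfolding variety_dim_def tuple_space_def
proof (rule krull_dim_le[OF comm_tuples_subset])
  let ?f = "\<lambda>y :: nat \<Rightarrow> 'k. line_tuple r 3 1 2 0 0 y"
  let ?g = "\<lambda>y :: nat \<Rightarrow> 'k. plane_tuple r 3 1 2 0 0 y"
  show "finite {?f, ?g}" by simp
  show "comm_tuples r u1 \<subseteq> (\<Union>\<phi>\<in>{?f, ?g}. range \<phi>)"
  proof
    fix x :: "nat \<Rightarrow> 'k ^ 3 ^ 3" assume x: "x \<in> comm_tuples r u1"
    obtain a b c where eq: "x = flag_tuple r 3 1 2 0 0 0 a b c" using comm_tuples_u1_cases[OF x] by blast
    have "x \<in> comm_tuples r nil1" using x by (simp add: comm_tuples_u1_iff)
    moreover have "CHAR('k) > 0" using ch by simp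
    ultimately have mem: "(\<forall>n<r. a n * b n = 0) \<and> (\<forall>n<r. \<forall>n'<r. a n * b n' = a n' * b n)"
      using flag_tuple_in_comm_tuples_nil1[of 3 1 2 r 0 0 0 a b c] ch unfolding eq by simp
    have rank: "\<forall>n<r. \<forall>n'<r. a n * b n' = a n' * b n" using mem ..
    have sq: "\<forall>n<r. a n * b n = 0" using mem ..
    from flag_tuple_eq_line_or_plane_tuple[OF rank sq, where u = 0 and t = 0 and m = 0 and c = c and i = 3 and j = 1 and k = 2]
    obtain y where "x = ?f y \<or> x = ?g y" unfolding eq by auto
    then show "x \<in> (\<Union>\<phi>\<in>{?f, ?g}. range \<phi>)" by blast
  qed
  show "(\<lambda>y. x (\<phi> y)) \<in> poly_funs (coords (2 * r))"
    if "\<phi> \<in> {?f, ?g}" "x \<in> tuple_coords r" for \<phi> x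
    using that
    by (auto intro!: line_tuple_poly_funs plane_tuple_poly_funs poly_funs.const)
qed

text \<open>
  The first \<open>2 r\<close> parameters are entries in the first row; \<open>u\<close> and \<open>t\<close> turn the image out of the first
  coordinate line and make the second and third row nonzero.
\<close>

lemma line_tuple_witness:
  fixes r :: nat
  defines "\<phi> \<equiv> (\<lambda>y :: nat \<Rightarrow> 'k::field. line_tuple r 3 1 2 (y (2 * r)) (y (2 * r + 1)) y)"
  assumes r: "r \<ge> 1" and i: "i < 2 * r + 2"
  shows "\<exists>f\<in>poly_funs (tuple_coords r).
    (\<forall>y\<in>affine_sub i. f (\<phi> y) = 0) \<and> (\<exists>y\<in>affine_sub (Suc i). f (\<phi> y) \<noteq> 0)"
proof -
  \<comment> \<open>On \<open>affine_sub (Suc i)\<close> every witness below is a monomial in the parameters up to \<open>i\<close>.\<close>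
  define e :: "nat \<Rightarrow> 'k" where "e l = (if l \<le> i then 1 else 0)" for l
  have e: "e \<in> affine_sub (Suc i)" by (auto simp: affine_sub_def e_def)
  have entry: "(\<lambda>x. x n $ p $ q) \<in> poly_funs (tuple_coords r)" if "n < r" for n p q
    using that by (intro poly_funs.coord) auto
  have \<phi>: "\<phi> y n = flag_mat 3 1 2 (y (2 * r)) (y (2 * r + 1)) 0 (y (r + n)) 0 (y n)" if "n < r" for y n
    using that by (simp add: \<phi>_def line_tuple_def flag_tuple_apply)
  note simps = \<phi> flag_mat_def affine_sub_def e_def
  consider "i < r" | n where "n < r" "i = r + n" | "i = 2 * r" | "i = 2 * r + 1"
  proof -
    have "i < r \<or> (i - r < r \<and> i = r + (i - r)) \<or> i = 2 * r \<or> i = 2 * r + 1" using i by arith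
    then show ?thesis using that by metis
  qed
  then show ?thesis
  proof cases
    case 1
    then show ?thesis using e by (intro bexI[OF _ entry[of i 3 2]] conjI bexI[of _ e]) (auto simp: simps)
  next
    case (2 n)
    then show ?thesis using e by (intro bexI[OF _ entry[of n 3 1]] conjI bexI[of _ e]) (auto simp: simps)
  next
    case 3
    then show ?thesis using e r by (intro bexI[OF _ entry[of 0 1 1]] conjI bexI[of _ e]) (auto simp: simps)
  next
    case 4
    then show ?thesis using e r by (intro bexI[OF _ entry[of 0 2 2]] conjI bexI[of _ e]) (auto simp: simps)
  qed
qed

lemma dim_comm_ge_char_2:
  assumes r: "r \<ge> 1" and ch: "CHAR('k::alg_closed_field) = 2"
  shows "variety_dim r (comm_tuples r (nil1 :: ('k ^ 3 ^ 3) set)) \<ge> enat (2 * r + 2)"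
    and "variety_dim r (comm_tuples r (u1 :: ('k ^ 3 ^ 3) set)) \<ge> enat (2 * r)"
proof -
  let ?\<phi> = "\<lambda>y :: nat \<Rightarrow> 'k. line_tuple r 3 1 2 (y (2 * r)) (y (2 * r + 1)) y"
  have poly: "(\<lambda>y. x (?\<phi> y)) \<in> poly_funs (coords (2 * r + 2))" if "x \<in> tuple_coords r" for x
    using that by (intro line_tuple_poly_funs coords_in_poly_funs) auto
  have nil: "?\<phi> y \<in> comm_tuples r nil1" for y
    unfolding line_tuple_def using ch by (subst flag_tuple_in_comm_tuples_nil1) auto
  have "?\<phi> y n \<in> strict_upper" if "y \<in> affine_sub (2 * r)" "n < r" for y n
    using that by (auto simp: affine_sub_def line_tuple_def flag_tuple_apply strict_upper_iff_flag_mat)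
  then have u: "?\<phi> ` affine_sub (2 * r) \<subseteq> comm_tuples r u1"
    using nil by (auto simp: comm_tuples_u1_iff)
  show "variety_dim r (comm_tuples r (nil1 :: ('k ^ 3 ^ 3) set)) \<ge> enat (2 * r + 2)"
    unfolding variety_dim_def tuple_space_def
    by (rule krull_dim_ge[where \<phi> = ?\<phi>, OF infinite_UNIV_alg_closed comm_tuples_subset poly])
      (assumption, use nil in blast, rule line_tuple_witness[OF r])
  show "variety_dim r (comm_tuples r (u1 :: ('k ^ 3 ^ 3) set)) \<ge> enat (2 * r)"
    unfolding variety_dim_def tuple_space_def
    by (rule krull_dim_ge[where \<phi> = ?\<phi>, OF infinite_UNIV_alg_closed comm_tuples_subset poly u])
      (assumption, rule line_tuple_witness[OF r], simp)
qed

section \<open>The dimensions\<close>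

theorem corollary3p4p1:
  fixes p r :: nat
  assumes "CHAR('k::alg_closed_field) = p" and "p > 0" and "r \<ge> 1"
  shows "variety_dim r (comm_tuples r (u1 :: ('k ^ 3 ^ 3) set)) =
           (if p \<noteq> 2 then enat (2 * r + 1) else enat (2 * r))
       \<and> variety_dim r (comm_tuples r (nil1 :: ('k ^ 3 ^ 3) set)) =
           (if p \<noteq> 2 then enat (2 * r + 4) else enat (2 * r + 2))"
proof (cases "p = 2")
  case True
  then have "CHAR('k) = 2" using assms(1) by simp
  then show ?thesis
    using True dim_comm_u1_le_char_2[where 'k = 'k, of r] dim_comm_nil1_le_char_2[where 'k = 'k, of r]
      dim_comm_ge_char_2[OF assms(3), where 'k = 'k] by (simp add: antisym)
next
  case False
  then have "CHAR('k) > 0" "CHAR('k) \<noteq> 2" using assms(1,2) by simp_all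
  then show ?thesis
    using False dim_comm_u1_le[OF assms(3), where 'k = 'k] dim_comm_nil1_le[OF assms(3), where 'k = 'k]
      dim_comm_ge_char_neq_2[OF assms(3), where 'k = 'k] by (simp add: antisym)
qed

end
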